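(* There is a universal constant $K>0$ such that the following holds. Let $F\colon\mathbb{R}^{d_x}\times\mathbb{R}^{d_y}\to\mathbb{R}$ be a differentiable function satisfying the following, with constants $L_x\ge\mu_x\ge0$, $L_y\ge\mu_y\ge0$, $L_{xy}>0$, $\mu_{xy},\mu_{yx}\ge0$: (1) $F(x,y)$ is $L_x$-smooth and $\mu_x$-strongly convex in $x$, and $L_y$-smooth and $\mu_y$-strongly concave in $y$; (2) for all $x,x_1,x_2\in\mathbb{R}^{d_x}$ and $y,y_1,y_2\in\mathbb{R}^{d_y}$: $\|\nabla_xF(x,y_1)-\nabla_xF(x,y_2)\|\le L_{xy}\|y_1-y_2\|$ and $\|\nabla_yF(x_1,y)-\nabla_yF(x_2,y)\|\le L_{xy}\|x_1-x_2\|$; (3) for all $x,x_1,x_2\in\mathbb{R}^{d_x}$ and $y,y_1,y_2\in\mathbb{R}^{d_y}$: $\|\nabla_xF(x,y_1)-\nabla_xF(x,y_2)\|\ge\mu_{xy}\|y_1-y_2\|$ and $\|\nabla_yF(x_1,y)-\nabla_yF(x_2,y)\|\ge\mu_{yx}\|x_1-x_2\|$; (4) $\min\{\max\{\mu_x,\mu_{yx}\},\max\{\mu_y,\mu_{xy}\}\}>0$. Then there exist parameters $\eta_x,\eta_y>0$, $\theta\in(0,1)$ of Algorithm GDAE (described in the context) such that its iteration complexity for finding an $\epsilon$-accurate solution of $\min_{x\in\mathbb{R}^{d_x}}\max_{y\in\mathbb{R}^{d_y}}F(x,y)$ is $$\mathcal{O}\left(\min\{T_a,T_b,T_c,T_d\}\log\frac{C}{\epsilon}\right),$$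 i.e., for all starting points $x^0\in\mathbb{R}^{d_x}$, $y^0\in\mathbb{R}^{d_y}$ there is a constant $C>0$, independent of $\epsilon$, such that for every $\epsilon>0$ GDAE produces an $\epsilon$-accurate solution $(x^k,y^k)$ for some $k\le\left\lceil K\min\{T_a,T_b,T_c,T_d\}\max\{0,\log(C/\epsilon)\}\right\rceil$, where $$T_a=\max\left\{\tfrac{L_x}{\mu_x},\tfrac{L_y}{\mu_y},\tfrac{L_{xy}}{\sqrt{\mu_x\mu_y}}\right\},\qquad T_b=\max\left\{\tfrac{L_x}{\mu_x},\tfrac{L_xL_y}{\mu_{xy}^2},\tfrac{L_{xy}^2}{\mu_{xy}^2}\right\},$$ $$T_c=\max\left\{\tfrac{L_y}{\mu_y},\tfrac{L_xL_y}{\mu_{yx}^2},\tfrac{L_{xy}^2}{\mu_{yx}^2}\right\},\qquad T_d=\max\left\{\tfrac{L_xL_y}{\mu_{xy}^2},\tfrac{L_xL_y}{\mu_{yx}^2},\tfrac{L_{xy}^2}{\mu_{xy}^2},\tfrac{L_{xy}^2}{\mu_{yx}^2}\right\}.$$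
   Context: Convention: any ratio with zero denominator equals $+\infty$. Norms are Euclidean. A differentiable $h\colon\mathbb{R}^d\to\mathbb{R}$ is $L$-smooth and $\mu$-strongly convex ($L\ge\mu\ge0$) if for all $z_1,z_2$: $\frac{\mu}{2}\|z_1-z_2\|^2\le h(z_1)-h(z_2)-\langle\nabla h(z_2),z_1-z_2\rangle\le\frac{L}{2}\|z_1-z_2\|^2$. "$F$ is $L_x$-smooth and $\mu_x$-strongly convex in $x$" means that $F(\cdot,y)$ has this property for every $y$; "$L_y$-smooth and $\mu_y$-strongly concave in $y$" means that $-F(x,\cdot)$ is $L_y$-smooth and $\mu_y$-strongly convex for every $x$. Solution set: $\mathcal{S}$ is the set of $(x^*,y^* )$ with $\nabla_xF(x^*,y^* )=0$ and $\nabla_yF(x^*,y^* )=0$. A pair $(x,y)$ is an $\epsilon$-accurate solution if $\min_{(x^*,y^* )\in\mathcal{S}}\max\{\|x-x^*\|^2,\|y-y^*\|^2\}\le\epsilon$. The iteration complexity is the number of iterations the algorithm requires to find an $\epsilon$-accurate solution. Algorithm GDAE. Input: $x^0\in\mathbb{R}^{d_x}$, $y^0\in\mathbb{R}^{d_y}$, $\eta_x,\eta_y>0$, $\theta\in(0,1)$. Set $x^{-1}=x^0$, $y^{-1}=y^0$. For $k=0,1,2,\ldots$: $x^{k+1}=x^k-\eta_x\nabla_xF(x^k,y^k)-\eta_x\theta\left(\nabla_xF(x^{k-1},y^k)-\nabla_xF(x^{k-1},y^{k-1})\right)$; $y^{k+1}=y^k+\eta_y\nabla_yF(x^{k+1},y^k)$.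 *)

theory Defs
  imports "HOL-Analysis.Analysis"
begin

text \<open>
  The constant \<open>K\<close> of the theorem must not depend on the dimensions, so \<open>d\<^sub>x\<close> and \<open>d\<^sub>y\<close>
  have to be quantified inside the formula and cannot be index types. All spaces \<open>R\<^sup>d\<close>
  are therefore realised inside one inner product space, the finitely supported real
  sequences: \<open>R\<^sup>d\<close> is the subspace \<open>Rn d\<close> of sequences vanishing from index \<open>d\<close> on (the same
  encoding as the carrier of \<^const>\<open>Euclidean_space\<close>), with the Euclidean inner product.
\<close>

typedef fsvec = "{f :: nat \<Rightarrow> real. finite {i. f i \<noteq> 0}}"
  morphisms coord Abs_fsvec
  by (rule exI[of _ "\<lambda>_. 0"]) simp

setup_lifting type_definition_fsvec

lemma finite_coord: "finite {i. coord x i \<noteq> 0}"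
  using coord by blast

lemma fsvec_eqI: "(\<And>i. coord x i = coord y i) \<Longrightarrow> x = y"
  by (simp add: coord_inject[symmetric] ext)

instantiation fsvec :: real_vector
begin

lift_definition zero_fsvec :: fsvec is "\<lambda>_. 0" by simp

lift_definition plus_fsvec :: "fsvec \<Rightarrow> fsvec \<Rightarrow> fsvec" is "\<lambda>f g i. f i + g i"
  subgoal for f g
    by (rule finite_subset[of _ "{i. f i \<noteq> 0} \<union> {i. g i \<noteq> 0}"]) auto
  done

lift_definition uminus_fsvec :: "fsvec \<Rightarrow> fsvec" is "\<lambda>f i. - f i" by simp

lift_definition minus_fsvec :: "fsvec \<Rightarrow> fsvec \<Rightarrow> fsvec" is "\<lambda>f g i. f i - g i"
  subgoal for f g
    by (rule finite_subset[of _ "{i. f i \<noteq> 0} \<union> {i. g i \<noteq> 0}"]) auto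
  done

lift_definition scaleR_fsvec :: "real \<Rightarrow> fsvec \<Rightarrow> fsvec" is "\<lambda>r f i. r * f i"
  by (rule rev_finite_subset) auto

instance
  by standard (transfer; simp add: fun_eq_iff algebra_simps)+

end

lemma coord_simps [simp]:
  "coord 0 i = 0"
  "coord (x + y) i = coord x i + coord y i"
  "coord (- x) i = - coord x i"
  "coord (x - y) i = coord x i - coord y i"
  "coord (r *\<^sub>R x) i = r * coord x i"
  by (transfer; simp)+

instantiation fsvec :: real_inner
begin

definition inner_fsvec :: "fsvec \<Rightarrow> fsvec \<Rightarrow> real" where
  "inner_fsvec x y = (\<Sum>i | coord x i \<noteq> 0. coord x i * coord y i)"

definition norm_fsvec :: "fsvec \<Rightarrow> real" where
  "norm_fsvec x = sqrt (x \<bullet> x)"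

definition sgn_fsvec :: "fsvec \<Rightarrow> fsvec" where
  "sgn_fsvec x = x /\<^sub>R norm x"

definition dist_fsvec :: "fsvec \<Rightarrow> fsvec \<Rightarrow> real" where
  "dist_fsvec x y = norm (x - y)"

definition uniformity_fsvec :: "(fsvec \<times> fsvec) filter" where
  "uniformity_fsvec = (INF e\<in>{0<..}. principal {(x, y). dist x y < e})"

definition open_fsvec :: "fsvec set \<Rightarrow> bool" where
  "open_fsvec U \<longleftrightarrow> (\<forall>x\<in>U. \<forall>\<^sub>F (x', y) in uniformity. x' = x \<longrightarrow> y \<in> U)"

lemma inner_fsvec_eq_sum:
  assumes "finite I" "{i. coord x i \<noteq> 0} \<subseteq> I"
  shows "x \<bullet> y = (\<Sum>i\<in>I. coord x i * coord y i)"
  unfolding inner_fsvec_def using assms by (intro sum.mono_neutral_left) auto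

instance
proof
  fix x y z :: fsvec and r :: real
  let ?I = "{i. coord x i \<noteq> 0} \<union> {i. coord y i \<noteq> 0}"
  have I: "finite ?I" by (simp add: finite_coord)
  show "x \<bullet> y = y \<bullet> x"
    by (subst (1 2) inner_fsvec_eq_sum[OF I]) (auto simp: mult.commute)
  show "(x + y) \<bullet> z = x \<bullet> z + y \<bullet> z"
    by (subst (1 2 3) inner_fsvec_eq_sum[OF I]) (auto simp: sum.distrib algebra_simps)
  show "(r *\<^sub>R x) \<bullet> y = r * (x \<bullet> y)"
    by (subst (1 2) inner_fsvec_eq_sum[OF I]) (auto simp: sum_distrib_left algebra_simps)
  show "0 \<le> x \<bullet> x"
    unfolding inner_fsvec_def by (intro sum_nonneg) simp
  show "x \<bullet> x = 0 \<longleftrightarrow> x = 0"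
    unfolding inner_fsvec_def
    by (subst sum_nonneg_eq_0_iff) (auto simp: finite_coord intro: fsvec_eqI)
qed (simp_all add: norm_fsvec_def sgn_fsvec_def dist_fsvec_def uniformity_fsvec_def open_fsvec_def)

end

definition Rn :: "nat \<Rightarrow> fsvec set" where
  "Rn d = {x. \<forall>i\<ge>d. coord x i = 0}"

lemma subspace_Rn: "subspace (Rn d)"
  by (auto simp: subspace_def Rn_def)

lemma inner_Rn: "x \<in> Rn d \<Longrightarrow> x \<bullet> y = (\<Sum>i<d. coord x i * coord y i)"
  by (rule inner_fsvec_eq_sum) (auto simp: Rn_def not_le[symmetric])

lemma norm_Rn: "x \<in> Rn d \<Longrightarrow> norm x = L2_set (coord x) {..<d}"
  by (simp add: norm_fsvec_def inner_Rn L2_set_def power2_eq_square)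

lemma coord_bij_betw_Rn: "bij_betw coord (Rn d) (topspace (Euclidean_space d))"
proof (rule bij_betwI')
  fix f assume "f \<in> topspace (Euclidean_space d)"
  then have f: "\<forall>i\<ge>d. f i = 0" by (simp add: topspace_Euclidean_space)
  then have "{i. f i \<noteq> 0} \<subseteq> {..<d}" by (auto simp: not_le[symmetric])
  then have "coord (Abs_fsvec f) = f"
    by (simp add: Abs_fsvec_inverse finite_subset)
  then show "\<exists>x\<in>Rn d. f = coord x"
    using f by (intro bexI[of _ "Abs_fsvec f"]) (auto simp: Rn_def)
qed (auto simp: coord_inject Rn_def topspace_Euclidean_space)


text \<open>
  A real function on \<open>R\<^sup>d\<close> is a total function on \<^typ>\<open>fsvec\<close> of which only the values on
  \<open>Rn d\<close> matter. Differentiation is within \<open>Rn d\<close>, which pins the derivative down only on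
  vectors of \<open>Rn d\<close>; the gradient is its unique representative in \<open>Rn d\<close>.
\<close>

definition grad :: "nat \<Rightarrow> (fsvec \<Rightarrow> real) \<Rightarrow> fsvec \<Rightarrow> fsvec" where
  "grad d h x = (THE g. g \<in> Rn d \<and> (h has_derivative (\<lambda>v. g \<bullet> v)) (at x within Rn d))"

definition grad_x :: "nat \<Rightarrow> (fsvec \<Rightarrow> fsvec \<Rightarrow> real) \<Rightarrow> fsvec \<Rightarrow> fsvec \<Rightarrow> fsvec" where
  "grad_x dx F x y = grad dx (\<lambda>u. F u y) x"

definition grad_y :: "nat \<Rightarrow> (fsvec \<Rightarrow> fsvec \<Rightarrow> real) \<Rightarrow> fsvec \<Rightarrow> fsvec \<Rightarrow> fsvec" where
  "grad_y dy F x y = grad dy (\<lambda>v. F x v) y"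

definition smooth_strongly_convex :: "nat \<Rightarrow> real \<Rightarrow> real \<Rightarrow> (fsvec \<Rightarrow> real) \<Rightarrow> bool" where
  "smooth_strongly_convex d L \<mu> h \<longleftrightarrow>
     h differentiable_on Rn d \<and>
     (\<forall>z1\<in>Rn d. \<forall>z2\<in>Rn d.
        \<mu> / 2 * (norm (z1 - z2))\<^sup>2 \<le> h z1 - h z2 - grad d h z2 \<bullet> (z1 - z2) \<and>
        h z1 - h z2 - grad d h z2 \<bullet> (z1 - z2) \<le> L / 2 * (norm (z1 - z2))\<^sup>2)"

definition solutions :: "nat \<Rightarrow> nat \<Rightarrow> (fsvec \<Rightarrow> fsvec \<Rightarrow> real) \<Rightarrow> (fsvec \<times> fsvec) set" where
  "solutions dx dy F =
     {(xs, ys). xs \<in> Rn dx \<and> ys \<in> Rn dy \<and> grad_x dx F xs ys = 0 \<and> grad_y dy F xs ys = 0}"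

definition sq_dist :: "fsvec \<times> fsvec \<Rightarrow> fsvec \<times> fsvec \<Rightarrow> real" where
  "sq_dist p q = max ((norm (fst p - fst q))\<^sup>2) ((norm (snd p - snd q))\<^sup>2)"

definition accurate_solution ::
    "nat \<Rightarrow> nat \<Rightarrow> (fsvec \<Rightarrow> fsvec \<Rightarrow> real) \<Rightarrow> real \<Rightarrow> fsvec \<times> fsvec \<Rightarrow> bool" where
  "accurate_solution dx dy F \<epsilon> p \<longleftrightarrow>
     (\<exists>q. is_arg_min (sq_dist p) (\<lambda>s. s \<in> solutions dx dy F) q \<and> sq_dist p q \<le> \<epsilon>)"

text \<open>
  The convention that iterate \<open>-1\<close> equals iterate \<open>0\<close> is truncated subtraction: for \<open>k = 0\<close>
  the index \<open>k - 1\<close> is \<open>0\<close>.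
\<close>

fun gdae :: "nat \<Rightarrow> nat \<Rightarrow> (fsvec \<Rightarrow> fsvec \<Rightarrow> real) \<Rightarrow> real \<Rightarrow> real \<Rightarrow> real \<Rightarrow>
    fsvec \<Rightarrow> fsvec \<Rightarrow> nat \<Rightarrow> fsvec \<times> fsvec" where
  "gdae dx dy F \<eta>x \<eta>y \<theta> x0 y0 0 = (x0, y0)"
| "gdae dx dy F \<eta>x \<eta>y \<theta> x0 y0 (Suc k) =
    (let (x, y) = gdae dx dy F \<eta>x \<eta>y \<theta> x0 y0 k;
         (x', y') = gdae dx dy F \<eta>x \<eta>y \<theta> x0 y0 (k - 1);
         x'' = x - \<eta>x *\<^sub>R grad_x dx F x y
                 - (\<eta>x * \<theta>) *\<^sub>R (grad_x dx F x' y - grad_x dx F x' y');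
         y'' = y + \<eta>y *\<^sub>R grad_y dy F x'' y
     in (x'', y''))"

text \<open>
  Any ratio with zero denominator is \<open>\<infinity>\<close>, including \<open>0 / 0\<close>, which is \<open>0\<close> for division on
  \<^typ>\<open>ereal\<close>.
\<close>

definition ratio :: "real \<Rightarrow> real \<Rightarrow> ereal" where
  "ratio a b = (if b = 0 then \<infinity> else ereal (a / b))"

definition T_a :: "real \<Rightarrow> real \<Rightarrow> real \<Rightarrow> real \<Rightarrow> real \<Rightarrow> ereal" where
  "T_a Lx Ly Lxy \<mu>x \<mu>y =
     Max {ratio Lx \<mu>x, ratio Ly \<mu>y, ratio Lxy (sqrt (\<mu>x * \<mu>y))}"

definition T_b :: "real \<Rightarrow> real \<Rightarrow> real \<Rightarrow> real \<Rightarrow> real \<Rightarrow> ereal" where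
  "T_b Lx Ly Lxy \<mu>x \<mu>xy =
     Max {ratio Lx \<mu>x, ratio (Lx * Ly) (\<mu>xy\<^sup>2), ratio (Lxy\<^sup>2) (\<mu>xy\<^sup>2)}"

definition T_c :: "real \<Rightarrow> real \<Rightarrow> real \<Rightarrow> real \<Rightarrow> real \<Rightarrow> ereal" where
  "T_c Lx Ly Lxy \<mu>y \<mu>yx =
     Max {ratio Ly \<mu>y, ratio (Lx * Ly) (\<mu>yx\<^sup>2), ratio (Lxy\<^sup>2) (\<mu>yx\<^sup>2)}"

definition T_d :: "real \<Rightarrow> real \<Rightarrow> real \<Rightarrow> real \<Rightarrow> real \<Rightarrow> ereal" where
  "T_d Lx Ly Lxy \<mu>xy \<mu>yx =
     Max {ratio (Lx * Ly) (\<mu>xy\<^sup>2), ratio (Lx * Ly) (\<mu>yx\<^sup>2),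
          ratio (Lxy\<^sup>2) (\<mu>xy\<^sup>2), ratio (Lxy\<^sup>2) (\<mu>yx\<^sup>2)}"

definition T_min ::
    "real \<Rightarrow> real \<Rightarrow> real \<Rightarrow> real \<Rightarrow> real \<Rightarrow> real \<Rightarrow> real \<Rightarrow> ereal" where
  "T_min Lx Ly Lxy \<mu>x \<mu>y \<mu>xy \<mu>yx =
     Min {T_a Lx Ly Lxy \<mu>x \<mu>y, T_b Lx Ly Lxy \<mu>x \<mu>xy,
          T_c Lx Ly Lxy \<mu>y \<mu>yx, T_d Lx Ly Lxy \<mu>xy \<mu>yx}"

text \<open>
  Under the hypotheses of the theorem the minimum is a real number, so that
  \<^const>\<open>real_of_ereal\<close>, which maps \<open>\<infinity>\<close> to \<open>0\<close>, is harmless.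
\<close>

lemma T_min_finite:
  assumes "Lxy > 0" "Lx \<ge> 0" "Ly \<ge> 0" "\<mu>x \<ge> 0" "\<mu>y \<ge> 0" "\<mu>xy \<ge> 0" "\<mu>yx \<ge> 0"
    and "min (max \<mu>x \<mu>yx) (max \<mu>y \<mu>xy) > 0"
  shows "\<bar>T_min Lx Ly Lxy \<mu>x \<mu>y \<mu>xy \<mu>yx\<bar> \<noteq> \<infinity>"
proof -
  have ratio: "ratio a b < \<infinity> \<longleftrightarrow> b \<noteq> 0" for a b
    by (simp add: ratio_def)
  have "(\<mu>x \<noteq> 0 \<or> \<mu>yx \<noteq> 0) \<and> (\<mu>y \<noteq> 0 \<or> \<mu>xy \<noteq> 0)"
    using assms(8) by (auto simp: less_max_iff_disj)
  then have "T_min Lx Ly Lxy \<mu>x \<mu>y \<mu>xy \<mu>yx < \<infinity>"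
    unfolding T_min_def T_a_def T_b_def T_c_def T_d_def
    by (subst Min_less_iff) (auto simp: ratio simp del: less_ereal.simps ereal_infty_less)
  moreover have "0 \<le> ratio a b" if "a \<ge> 0" "b \<ge> 0" for a b
    using that by (auto simp: ratio_def)
  then have "0 \<le> T_min Lx Ly Lxy \<mu>x \<mu>y \<mu>xy \<mu>yx"
    using assms by (simp add: T_min_def T_a_def T_b_def T_c_def T_d_def le_max_iff_disj)
  ultimately show ?thesis by auto
qed

end

theory Submission
  imports Defs
begin

text \<open>
  Write \<open>(x\<^sup>*, y\<^sup>*)\<close> for the solution and \<open>p\<close>, \<open>q\<close> for the step sizes. With
  \<open>e\<^sup>k = \<nabla>\<^sub>x F(x\<^sup>k\<^sup>-\<^sup>1, y\<^sup>k) - \<nabla>\<^sub>x F(x\<^sup>k\<^sup>-\<^sup>1, y\<^sup>k\<^sup>-\<^sup>1)\<close>, the energy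
  \<open>(1+\<rho>)/p \<parallel>x\<^sup>k-x\<^sup>*\<parallel>\<^sup>2 + (1+\<rho>)/q \<parallel>y\<^sup>k-y\<^sup>*\<parallel>\<^sup>2 - 2\<langle>e\<^sup>k, x\<^sup>k-x\<^sup>*\<rangle> + \<parallel>y\<^sup>k-y\<^sup>k\<^sup>-\<^sup>1\<parallel>\<^sup>2/(4q)\<close>
  shrinks by the factor \<open>\<theta> = 1/(1+\<rho>)\<close> in every step. The four Bregman distances which
  convexity and concavity leave over have, besides their strong convexity lower bounds, the lower
  bound \<open>\<parallel>gradient difference\<parallel>\<^sup>2/(2L)\<close>; together with the lower bounds on the coupling this
  gives the effective moduli \<open>max {\<mu>\<^sub>x, q \<mu>\<^sub>y\<^sub>x\<^sup>2/8}\<close> in \<open>x\<close> and \<open>max {\<mu>\<^sub>y, p \<mu>\<^sub>x\<^sub>y\<^sup>2/8}\<close> in \<open>y\<close>.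
  In each of the four cases suitable step sizes then give \<open>\<rho> = 1/(512 T)\<close>.
  The same Bregman distances show that the inverse of the monotone operator
  \<open>(\<nabla>\<^sub>x F, -\<nabla>\<^sub>y F)\<close> is Lipschitz, so that a solution exists and is unique.
\<close>


section \<open>Gradients on the subspaces \<open>Rn d\<close>\<close>

text \<open>The space \<open>fsvec\<close> itself is not complete, so each \<open>Rn d\<close> has
  to be treated on its own. Coordinates converge because the norm dominates them; conversely the sum
  of the first d absolute coordinates dominates the norm, which makes the coordinatewise limit a
  limit in norm.\<close>

lemma complete_Rn: "complete (Rn d)"
proof (rule completeI)
  fix f assume f: "\<forall>n. f n \<in> Rn d" and "Cauchy f"
  have abs_coord_le: "\<bar>coord v i\<bar> \<le> norm v" if "v \<in> Rn d" for v i
  proof (cases "i < d")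
    case True
    then show ?thesis
      using member_le_L2_set[of "{..<d}" i "\<lambda>i. \<bar>coord v i\<bar>"] that
      by (simp add: norm_Rn L2_set_def)
  qed (use that in \<open>simp add: Rn_def\<close>)
  have diff: "f m - f n \<in> Rn d" for m n
    using f subspace_Rn subspace_diff by blast
  have "convergent (\<lambda>n. coord (f n) i)" for i
  proof (rule Cauchy_convergent, rule metric_CauchyI)
    fix e :: real assume "e > 0"
    then obtain N where N: "\<forall>m\<ge>N. \<forall>n\<ge>N. dist (f m) (f n) < e"
      using \<open>Cauchy f\<close> by (auto dest: metric_CauchyD)
    have "dist (coord (f m) i) (coord (f n) i) \<le> dist (f m) (f n)" for m n
      using abs_coord_le[OF diff, of m n i] by (simp add: dist_real_def dist_norm)
    with N show "\<exists>M. \<forall>m\<ge>M. \<forall>n\<ge>M. dist (coord (f m) i) (coord (f n) i) < e"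
      by (meson le_less_trans)
  qed
  then obtain l where l: "(\<lambda>n. coord (f n) i) \<longlonglongrightarrow> l i" for i
    unfolding convergent_def by metis
  have l0: "l i = 0" if "d \<le> i" for i
    using l[of i] f that by (simp add: Rn_def LIMSEQ_const_iff)
  define v where "v = Abs_fsvec l"
  have "{i. l i \<noteq> 0} \<subseteq> {..<d}"
    using l0 by (auto simp: not_le[symmetric])
  then have v: "coord v = l"
    by (simp add: v_def Abs_fsvec_inverse finite_subset)
  have "v \<in> Rn d"
    using l0 by (simp add: Rn_def v)
  have "(\<lambda>n. \<Sum>i<d. \<bar>coord (f n - v) i\<bar>) \<longlonglongrightarrow> 0"
    using l by (intro tendsto_null_sum tendsto_rabs_zero) (simp add: v LIM_zero)
  moreover have "norm (f n - v) \<le> (\<Sum>i<d. \<bar>coord (f n - v) i\<bar>)" for n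
    using norm_Rn[OF subspace_diff[OF subspace_Rn f[rule_format] \<open>v \<in> Rn d\<close>]]
      L2_set_le_sum_abs[of "coord (f n - v)" "{..<d}"] by simp
  ultimately have "(\<lambda>n. f n - v) \<longlonglongrightarrow> 0"
    by (rule Lim_null_comparison[OF always_eventually[OF allI], rotated])
  then show "\<exists>l\<in>Rn d. f \<longlonglongrightarrow> l"
    using \<open>v \<in> Rn d\<close> by (auto simp: LIM_zero_iff)
qed

text \<open>Derivatives within a proper subspace are not unique as linear maps on
  \<open>fsvec\<close>. Two representatives g and k in \<open>Rn d\<close> are therefore compared
  along the line through x with direction \<open>k - g\<close>, which stays in \<open>Rn d\<close>;
  there the derivative is unique, and this gives
  \<open>(k - g) \<bullet> (k - g) = 0\<close>.\<close>

lemma grad_eqI: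
  assumes "x \<in> Rn d" "g \<in> Rn d" and g: "(h has_derivative (\<lambda>v. g \<bullet> v)) (at x within Rn d)"
  shows "grad d h x = g"
  unfolding grad_def
proof (rule the_equality)
  fix k assume k: "k \<in> Rn d \<and> (h has_derivative (\<lambda>v. k \<bullet> v)) (at x within Rn d)"
  define w where "w = k - g"
  have w: "w \<in> Rn d"
    using assms(2) k subspace_Rn by (auto simp: w_def intro: subspace_diff)
  have line: "x + t *\<^sub>R w \<in> Rn d" for t
    using assms(1) w subspace_Rn by (auto intro: subspace_add subspace_scale)
  have along: "((\<lambda>t. h (x + t *\<^sub>R w)) has_derivative (\<lambda>t. u \<bullet> (t *\<^sub>R w))) (at 0)"
    if "(h has_derivative (\<lambda>v. u \<bullet> v)) (at x within Rn d)" for u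
  proof (rule has_derivative_in_compose[where f = "\<lambda>t. x + t *\<^sub>R w" and x = 0
        and s = UNIV, simplified])
    show "((\<lambda>t. x + t *\<^sub>R w) has_derivative (\<lambda>t. t *\<^sub>R w)) (at 0)"
      by (auto intro!: derivative_eq_intros)
    show "(h has_derivative (\<lambda>v. u \<bullet> v)) (at x within range (\<lambda>t. x + t *\<^sub>R w))"
      using line by (intro has_derivative_subset[OF that]) auto
  qed
  have "(\<lambda>t::real. k \<bullet> (t *\<^sub>R w)) = (\<lambda>t. g \<bullet> (t *\<^sub>R w))"
    using k g by (blast intro: has_derivative_unique along)
  from fun_cong[OF this, of 1] have "w \<bullet> w = 0"
    by (simp add: w_def inner_diff_left)
  then show "k = g"
    by (simp add: w_def)
qed (use assms in blast)

text \<open>The Riesz representative is assembled from the values of the derivative at the d unit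
  vectors.\<close>

lemma
  assumes "h differentiable_on Rn d" "x \<in> Rn d"
  shows grad_in_Rn: "grad d h x \<in> Rn d"
    and has_derivative_grad: "(h has_derivative (\<lambda>v. grad d h x \<bullet> v)) (at x within Rn d)"
proof -
  obtain D where D: "(h has_derivative D) (at x within Rn d)"
    using assms by (auto simp: differentiable_on_def differentiable_def)
  then interpret D: bounded_linear D
    by (rule has_derivative_bounded_linear)
  define e where "e i = Abs_fsvec (\<lambda>j. if j = i then 1 else 0)" for i :: nat
  have e: "coord (e i) j = (if j = i then 1 else 0)" for i j
    by (simp add: e_def Abs_fsvec_inverse)
  define g where "g = Abs_fsvec (\<lambda>i. if i < d then D (e i) else 0)"
  have g: "coord g i = (if i < d then D (e i) else 0)" for i
    unfolding g_def by (subst Abs_fsvec_inverse) (auto intro: finite_subset[of _ "{..<d}"])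
  have "g \<in> Rn d"
    by (simp add: Rn_def g)
  have coord_sum: "coord (sum f A) j = (\<Sum>i\<in>A. coord (f i) j)" for f :: "nat \<Rightarrow> fsvec" and A j
    by (induction A rule: infinite_finite_induct) auto
  have D_eq: "D v = g \<bullet> v" if "v \<in> Rn d" for v
  proof -
    have "v = (\<Sum>i<d. coord v i *\<^sub>R e i)"
    proof (rule fsvec_eqI)
      fix j
      show "coord v j = coord (\<Sum>i<d. coord v i *\<^sub>R e i) j"
        using that by (auto simp: coord_sum e Rn_def if_distrib sum.delta cong: if_cong)
    qed
    then have "D v = D (\<Sum>i<d. coord v i *\<^sub>R e i)"
      by simp
    also have "\<dots> = (\<Sum>i<d. coord v i * D (e i))"
      by (simp add: D.sum D.scaleR)
    finally show ?thesis
      using \<open>g \<in> Rn d\<close> by (simp add: inner_Rn g mult.commute)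
  qed
  have "(h has_derivative (\<lambda>v. g \<bullet> v)) (at x within Rn d)"
    unfolding has_derivative_within
  proof (intro conjI bounded_linear_inner_right)
    have "((\<lambda>y. (1 / norm (y - x)) *\<^sub>R (h y - (h x + D (y - x)))) \<longlongrightarrow> 0) (at x within Rn d)"
      using D by (simp add: has_derivative_within)
    \<comment> \<open>D and \<open>g \<bullet> _\<close> may differ off \<open>Rn d\<close>, but the
      filter only sees increments inside it.\<close>
    moreover have "\<forall>\<^sub>F y in at x within Rn d. D (y - x) = g \<bullet> (y - x)"
      unfolding eventually_at_filter
      using D_eq assms(2) subspace_diff[OF subspace_Rn] by simp
    then have "\<forall>\<^sub>F y in at x within Rn d. (1 / norm (y - x)) *\<^sub>R (h y - (h x + D (y - x)))
        = (1 / norm (y - x)) *\<^sub>R (h y - (h x + g \<bullet> (y - x)))"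
      by eventually_elim simp
    ultimately show "((\<lambda>y. (1 / norm (y - x)) *\<^sub>R (h y - (h x + g \<bullet> (y - x)))) \<longlongrightarrow> 0)
        (at x within Rn d)"
      by (rule Lim_transform_eventually)
  qed
  with \<open>g \<in> Rn d\<close> grad_eqI[OF assms(2)] show "grad d h x \<in> Rn d"
    "(h has_derivative (\<lambda>v. grad d h x \<bullet> v)) (at x within Rn d)" by auto
qed

lemma grad_minus:
  assumes "h differentiable_on Rn d" "x \<in> Rn d"
  shows "grad d (\<lambda>v. - h v) x = - grad d h x"
  using grad_in_Rn[OF assms] has_derivative_minus[OF has_derivative_grad[OF assms]] assms(2)
  by (intro grad_eqI) (auto intro: subspace_neg subspace_Rn)


section \<open>Zeros of monotone operators\<close>

lemma norm_diff_scaleR_sq: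
  "(norm (a - t *\<^sub>R b))\<^sup>2 = (norm a)\<^sup>2 - 2 * t * (b \<bullet> a) + t\<^sup>2 * (norm b)\<^sup>2"
  for a b :: "'a::real_inner"
  unfolding power2_norm_eq_inner
  by (simp add: inner_diff_left inner_diff_right inner_commute power2_eq_square algebra_simps)

text \<open>Zeros of G are the fixed points of \<open>z - t *\<^sub>R G z\<close>. The value
  \<open>t = \<delta> / L\<^sup>2\<close> minimises the bound
  \<open>1 - 2 * t * \<delta> + t\<^sup>2 * L\<^sup>2\<close> on the squared contraction factor, and
  Banach's theorem applies.\<close>

lemma strongly_monotone_zero_exists:
  fixes G :: "'a::real_inner \<Rightarrow> 'a"
  assumes S: "subspace S" "complete S" and G_in: "\<And>z. z \<in> S \<Longrightarrow> G z \<in> S"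
    and lip: "\<And>z w. z \<in> S \<Longrightarrow> w \<in> S \<Longrightarrow> norm (G z - G w) \<le> L * norm (z - w)"
    and mono: "\<And>z w. z \<in> S \<Longrightarrow> w \<in> S \<Longrightarrow> \<delta> * (norm (z - w))\<^sup>2 \<le> (G z - G w) \<bullet> (z - w)"
    and \<delta>: "0 < \<delta>" "\<delta> \<le> L"
  shows "\<exists>z\<in>S. G z = 0"
proof -
  define t where "t = \<delta> / L\<^sup>2"
  have tL: "t\<^sup>2 * L\<^sup>2 = t * \<delta>" "t * \<delta> = (\<delta> / L)\<^sup>2" "t > 0"
    using \<delta> by (auto simp: t_def power2_eq_square)
  have "(\<delta> / L)\<^sup>2 \<le> 1"
    using \<delta> by (simp add: power_le_one)
  have contraction: "dist (z - t *\<^sub>R G z) (w - t *\<^sub>R G w) \<le> sqrt (1 - (\<delta> / L)\<^sup>2) * dist z w"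
    if zw: "z \<in> S" "w \<in> S" for z w
  proof -
    have "(norm ((z - w) - t *\<^sub>R (G z - G w)))\<^sup>2
        = (norm (z - w))\<^sup>2 - 2 * t * ((G z - G w) \<bullet> (z - w)) + t\<^sup>2 * (norm (G z - G w))\<^sup>2"
      by (rule norm_diff_scaleR_sq)
    also have "\<dots> \<le> (norm (z - w))\<^sup>2 - 2 * t * (\<delta> * (norm (z - w))\<^sup>2)
        + t\<^sup>2 * (L * norm (z - w))\<^sup>2"
      using tL(3) mono[OF zw] lip[OF zw] by (intro add_mono diff_mono mult_left_mono power_mono) auto
    also have "\<dots> = (1 - (\<delta> / L)\<^sup>2) * (norm (z - w))\<^sup>2"
      unfolding power_mult_distrib mult.assoc[symmetric] tL(1)
      by (simp add: tL(2)[symmetric] algebra_simps)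
    finally have "norm ((z - w) - t *\<^sub>R (G z - G w)) \<le> sqrt ((1 - (\<delta> / L)\<^sup>2) * (norm (z - w))\<^sup>2)"
      by (rule real_le_rsqrt)
    moreover have "z - t *\<^sub>R G z - (w - t *\<^sub>R G w) = (z - w) - t *\<^sub>R (G z - G w)"
      by (simp add: algebra_simps)
    ultimately show ?thesis
      unfolding dist_norm by (simp only: real_sqrt_mult real_sqrt_abs abs_norm_cancel)
  qed
  have "\<exists>!z\<in>S. z - t *\<^sub>R G z = z"
  proof (rule Banach_fix[OF \<open>complete S\<close>, where c = "sqrt (1 - (\<delta> / L)\<^sup>2)"])
    show "S \<noteq> {}" "(\<lambda>z. z - t *\<^sub>R G z) ` S \<subseteq> S"
      using S(1) G_in by (auto intro: subspace_0 subspace_diff subspace_scale)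
  qed (use \<open>(\<delta> / L)\<^sup>2 \<le> 1\<close> \<delta> contraction in auto)
  then show ?thesis
    using tL(3) by auto
qed

text \<open>Tikhonov regularisation: the zeros of \<open>G + \<delta> I\<close> form a Cauchy sequence as \<open>\<delta> \<rightarrow> 0\<close>.\<close>

lemma monotone_zero_exists:
  fixes G :: "'a::real_inner \<Rightarrow> 'a"
  assumes S: "subspace S" "complete S" and G_in: "\<And>z. z \<in> S \<Longrightarrow> G z \<in> S"
    and lip: "\<And>z w. z \<in> S \<Longrightarrow> w \<in> S \<Longrightarrow> norm (G z - G w) \<le> L * norm (z - w)"
    and mono: "\<And>z w. z \<in> S \<Longrightarrow> w \<in> S \<Longrightarrow> 0 \<le> (G z - G w) \<bullet> (z - w)"
    and inv: "\<And>z w. z \<in> S \<Longrightarrow> w \<in> S \<Longrightarrow> norm (z - w) \<le> C * norm (G z - G w)"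
    and "0 \<le> L" "0 \<le> C"
  shows "\<exists>z\<in>S. G z = 0"
proof -
  \<comment> \<open>Besides tending to 0, \<delta> satisfies
    \<open>C * \<delta> n \<le> 1 / 2\<close>; this lets the term
    \<open>C * \<delta> n * norm (z n)\<close> be absorbed when the zeros \<open>z n\<close> are
    bounded uniformly by B.\<close>
  define \<delta> where "\<delta> n = 1 / ((2 * C + 1) * real (Suc n))" for n
  have \<delta>: "0 < \<delta> n" "C * \<delta> n \<le> 1 / 2" for n
  proof -
    have "2 * C + 1 \<le> (2 * C + 1) * real (Suc n)"
      using mult_left_mono[of 1 "real (Suc n)" "2 * C + 1"] \<open>0 \<le> C\<close> by simp
    then have "0 < (2 * C + 1) * real (Suc n)" "2 * C \<le> (2 * C + 1) * real (Suc n)"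
      using \<open>0 \<le> C\<close> by linarith+
    then show "0 < \<delta> n" "C * \<delta> n \<le> 1 / 2"
      unfolding \<delta>_def times_divide_eq_right mult_1_right
      by (simp_all only: zero_less_divide_1_iff pos_divide_le_eq)
  qed
  have "\<delta> \<longlonglongrightarrow> 0"
    unfolding \<delta>_def using \<open>0 \<le> C\<close>
      tendsto_mult_right_zero[OF LIMSEQ_inverse_real_of_nat, of "1 / (2 * C + 1)"]
    by (simp add: field_simps)
  have "\<exists>z\<in>S. G z + \<delta> n *\<^sub>R z = 0" for n
  proof (rule strongly_monotone_zero_exists[OF S, where L = "L + \<delta> n"])
    fix z w assume zw: "z \<in> S" "w \<in> S"
    have eq: "G z + \<delta> n *\<^sub>R z - (G w + \<delta> n *\<^sub>R w) = (G z - G w) + \<delta> n *\<^sub>R (z - w)"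
      by (simp add: algebra_simps)
    show "norm (G z + \<delta> n *\<^sub>R z - (G w + \<delta> n *\<^sub>R w)) \<le> (L + \<delta> n) * norm (z - w)"
      unfolding eq distrib_right using lip[OF zw] \<delta>(1)[of n]
      by (intro norm_triangle_le add_mono) auto
    show "\<delta> n * (norm (z - w))\<^sup>2 \<le> (G z + \<delta> n *\<^sub>R z - (G w + \<delta> n *\<^sub>R w)) \<bullet> (z - w)"
      unfolding eq using mono[OF zw] by (simp add: inner_add_left power2_norm_eq_inner)
  qed (use S(1) G_in \<delta>(1) \<open>0 \<le> L\<close> in \<open>auto intro: subspace_add subspace_scale\<close>)
  then obtain z where z: "z n \<in> S" "G (z n) = - (\<delta> n *\<^sub>R z n)" for n
    by (metis add_eq_0_iff2)
  define B where "B = 2 * C * norm (G 0)"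
  have "norm (z n) \<le> B" for n
  proof -
    have "norm (z n - 0) \<le> C * norm (G (z n) - G 0)"
      using z(1) S(1) by (intro inv) (auto intro: subspace_0)
    also have "\<dots> \<le> C * (\<delta> n * norm (z n) + norm (G 0))"
      using \<open>0 \<le> C\<close> z(2)[of n] \<delta>(1)[of n] norm_triangle_ineq4[of "G (z n)" "G 0"]
      by (intro mult_left_mono) auto
    also have "\<dots> \<le> 1 / 2 * norm (z n) + C * norm (G 0)"
      using mult_right_mono[OF \<delta>(2)[of n] norm_ge_zero[of "z n"]] by (simp add: algebra_simps)
    finally show ?thesis
      by (simp add: B_def)
  qed
  then have small: "norm (G (z n)) \<le> \<delta> n * B" for n
    using \<delta>(1)[of n] by (simp add: z(2))
  \<comment> \<open>The values \<open>G (z n)\<close> tend to 0, and \<open>inv\<close> turns their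
    differences into distances of the \<open>z n\<close>.\<close>
  have "Cauchy z"
  proof (rule metric_CauchyI)
    fix e :: real assume "e > 0"
    have "(\<lambda>n. 2 * (C * (\<delta> n * B))) \<longlonglongrightarrow> 0"
      using \<open>\<delta> \<longlonglongrightarrow> 0\<close> by (auto intro!: tendsto_eq_intros)
    then have "\<forall>\<^sub>F n in sequentially. 2 * (C * (\<delta> n * B)) < e"
      using \<open>e > 0\<close> by (rule order_tendstoD)
    then obtain N where N: "2 * (C * (\<delta> n * B)) < e" if "n \<ge> N" for n
      by (auto simp: eventually_sequentially)
    have "dist (z m) (z n) < e" if "m \<ge> N" "n \<ge> N" for m n
    proof -
      have "dist (z m) (z n) \<le> C * norm (G (z m) - G (z n))"
        using inv z(1) by (simp add: dist_norm)
      also have "\<dots> \<le> C * (\<delta> m * B + \<delta> n * B)"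
        using \<open>0 \<le> C\<close> small[of m] small[of n] norm_triangle_ineq4[of "G (z m)" "G (z n)"]
        by (intro mult_left_mono) auto
      also have "\<dots> < e"
        using N[OF that(1)] N[OF that(2)] by (simp add: algebra_simps)
      finally show ?thesis .
    qed
    then show "\<exists>M. \<forall>m\<ge>M. \<forall>n\<ge>M. dist (z m) (z n) < e"
      by blast
  qed
  then obtain l where l: "l \<in> S" "z \<longlonglongrightarrow> l"
    using S(2) z(1) by (auto simp: complete_def)
  have "norm (G l) \<le> L * norm (l - z n) + \<delta> n * B" for n
    using norm_triangle_ineq[of "G l - G (z n)" "G (z n)"] lip[OF l(1) z(1)[of n]] small[of n]
    by simp
  moreover have "(\<lambda>n. L * norm (l - z n) + \<delta> n * B) \<longlonglongrightarrow> 0"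
    using \<open>\<delta> \<longlonglongrightarrow> 0\<close> l(2) by (auto intro!: tendsto_eq_intros)
  ultimately have "norm (G l) \<le> 0"
    by (meson LIMSEQ_le_const)
  with l(1) show ?thesis
    by auto
qed

lemma complete_Times:
  fixes A :: "'a::metric_space set" and B :: "'b::metric_space set"
  assumes "complete A" "complete B"
  shows "complete (A \<times> B)"
proof (rule completeI)
  fix f assume f: "\<forall>n. f n \<in> A \<times> B" and "Cauchy f"
  then have "Cauchy (\<lambda>n. fst (f n))" "Cauchy (\<lambda>n. snd (f n))" "fst (f n) \<in> A" "snd (f n) \<in> B" for n
    by (auto simp: mem_Times_iff Cauchy_fst Cauchy_snd)
  then obtain a b where "a \<in> A" "(\<lambda>n. fst (f n)) \<longlonglongrightarrow> a" "b \<in> B" "(\<lambda>n. snd (f n)) \<longlonglongrightarrow> b"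
    using completeE[OF assms(1), of "\<lambda>n. fst (f n)"] completeE[OF assms(2), of "\<lambda>n. snd (f n)"]
    by metis
  then show "\<exists>l\<in>A \<times> B. f \<longlonglongrightarrow> l"
    using tendsto_Pair[of "\<lambda>n. fst (f n)" a sequentially "\<lambda>n. snd (f n)" b] by auto
qed


section \<open>Bregman distances and saddle points\<close>

definition bregman :: "('a::real_inner \<Rightarrow> real) \<Rightarrow> ('a \<Rightarrow> 'a) \<Rightarrow> 'a \<Rightarrow> 'a \<Rightarrow> real" where
  "bregman h g a b = h a - h b - g b \<bullet> (a - b)"

text \<open>The gradient is a parameter, so that one notion covers both \<open>F\<close> in x with
  \<open>gx\<close> and \<open>- F\<close> in y with \<open>- gy\<close>, on any subspace.\<close>

definition smooth_convex_on ::
    "'a::real_inner set \<Rightarrow> real \<Rightarrow> real \<Rightarrow> ('a \<Rightarrow> real) \<Rightarrow> ('a \<Rightarrow> 'a) \<Rightarrow> bool" where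
  "smooth_convex_on S L \<mu> h g \<longleftrightarrow> (\<forall>b\<in>S. g b \<in> S) \<and>
     (\<forall>a\<in>S. \<forall>b\<in>S. \<mu> / 2 * (norm (a - b))\<^sup>2 \<le> bregman h g a b \<and>
        bregman h g a b \<le> L / 2 * (norm (a - b))\<^sup>2)"

lemma smooth_convex_onD:
  assumes "smooth_convex_on S L \<mu> h g" "a \<in> S" "b \<in> S"
  shows "g b \<in> S" "\<mu> / 2 * (norm (a - b))\<^sup>2 \<le> bregman h g a b"
    "bregman h g a b \<le> L / 2 * (norm (a - b))\<^sup>2"
  using assms by (auto simp: smooth_convex_on_def)

text \<open>Cocoercivity. Moving a by \<open>- t *\<^sub>R (g a - g b)\<close> changes the Bregman
  distance to b by at most \<open>- t * N + L / 2 * t\<^sup>2 * N\<close>, and the result is still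
  non-negative. The best choice is \<open>t = 1 / L\<close>.\<close>

lemma grad_diff_sq_le_bregman:
  assumes h: "smooth_convex_on S L \<mu> h g" and "subspace S" "0 \<le> \<mu>" "\<mu> \<le> L" and ab: "a \<in> S" "b \<in> S"
  shows "(norm (g a - g b))\<^sup>2 \<le> 2 * L * bregman h g a b"
proof -
  define N where "N = (norm (g a - g b))\<^sup>2"
  have descent: "t * N \<le> bregman h g a b + L / 2 * t\<^sup>2 * N" for t
  proof -
    define a' where "a' = a - t *\<^sub>R (g a - g b)"
    have "a' \<in> S"
      unfolding a'_def using ab smooth_convex_onD(1)[OF h] \<open>subspace S\<close>
      by (intro subspace_diff subspace_scale) auto
    have "0 \<le> \<mu> / 2 * (norm (a' - b))\<^sup>2"
      using \<open>0 \<le> \<mu>\<close> by simp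
    also have "\<dots> \<le> bregman h g a' b"
      using smooth_convex_onD(2)[OF h \<open>a' \<in> S\<close> ab(2)] .
    also have "\<dots> = bregman h g a b + bregman h g a' a + (g a - g b) \<bullet> (a' - a)"
      by (simp add: bregman_def algebra_simps)
    also have "(g a - g b) \<bullet> (a' - a) = - t * N"
      unfolding a'_def N_def power2_norm_eq_inner
      by (simp add: inner_diff_left inner_diff_right algebra_simps)
    also have "bregman h g a' a \<le> L / 2 * (norm (a' - a))\<^sup>2"
      using smooth_convex_onD(3)[OF h \<open>a' \<in> S\<close> ab(1)] .
    also have "(norm (a' - a))\<^sup>2 = t\<^sup>2 * N"
      by (simp add: a'_def N_def power_mult_distrib)
    finally show ?thesis
      by simp
  qed
  show ?thesis
  proof (cases "L = 0")
    case True
    \<comment> \<open>With L = 0 the bound is linear in t, so a large t refutes a positive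
      N.\<close>
    have "N = 0"
    proof (rule ccontr)
      assume "N \<noteq> 0"
      then show False
        using descent[of "(bregman h g a b + 1) / N"] True by simp
    qed
    with True show ?thesis
      by (simp add: N_def)
  next
    case False
    then have "L > 0"
      using assms(3,4) by simp
    with descent[of "1 / L"] show ?thesis
      by (simp add: N_def power2_eq_square field_simps)
  qed
qed

lemma norm_sum_sq_le2: "(norm (a + b))\<^sup>2 \<le> 2 * (norm a)\<^sup>2 + 2 * (norm b)\<^sup>2"
  for a b :: "'a::real_inner"
proof -
  have "(norm (a + b))\<^sup>2 \<le> (norm a + norm b)\<^sup>2"
    by (simp add: power_mono norm_triangle_ineq)
  with sum_squares_bound[of "norm a" "norm b"] show ?thesis
    by (simp add: power2_sum)
qed

lemma two_inner_le: "2 * \<bar>a \<bullet> b\<bar> \<le> s * (norm a)\<^sup>2 + (norm b)\<^sup>2 / s"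
  if "s > 0" for a b :: "'a::real_inner"
proof -
  have "2 * \<bar>a \<bullet> b\<bar> \<le> 2 * (norm a * norm b)"
    using Cauchy_Schwarz_ineq2[of a b] by simp
  also have "\<dots> \<le> s * (norm a)\<^sup>2 + (norm b)\<^sup>2 / s"
    using zero_le_power2[of "s * norm a - norm b"] that
    by (simp add: power2_eq_square field_simps)
  finally show ?thesis .
qed

section \<open>Saddle functions with abstract partial gradients, and their monotone operator\<close>

locale smooth_saddle =
  fixes X :: "'a::real_inner set" and Y :: "'b::real_inner set"
    and F :: "'a \<Rightarrow> 'b \<Rightarrow> real" and gx :: "'a \<Rightarrow> 'b \<Rightarrow> 'a" and gy :: "'a \<Rightarrow> 'b \<Rightarrow> 'b"
    and Lx Ly Lxy \<mu>x \<mu>y \<mu>xy \<mu>yx :: real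
  assumes X: "subspace X" and Y: "subspace Y"
    and convex_x: "\<And>y. y \<in> Y \<Longrightarrow> smooth_convex_on X Lx \<mu>x (\<lambda>x. F x y) (\<lambda>x. gx x y)"
    and concave_y: "\<And>x. x \<in> X \<Longrightarrow> smooth_convex_on Y Ly \<mu>y (\<lambda>y. - F x y) (\<lambda>y. - gy x y)"
    and const_bounds: "0 \<le> \<mu>x" "\<mu>x \<le> Lx" "0 \<le> \<mu>y" "\<mu>y \<le> Ly" "0 \<le> Lxy" "0 \<le> \<mu>xy" "0 \<le> \<mu>yx"
    and gx_upper: "\<And>x y y'. x \<in> X \<Longrightarrow> y \<in> Y \<Longrightarrow> y' \<in> Y \<Longrightarrow>
      norm (gx x y - gx x y') \<le> Lxy * norm (y - y')"
    and gy_upper: "\<And>x x' y. x \<in> X \<Longrightarrow> x' \<in> X \<Longrightarrow> y \<in> Y \<Longrightarrow>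
      norm (gy x y - gy x' y) \<le> Lxy * norm (x - x')"
    and gx_lower: "\<And>x y y'. x \<in> X \<Longrightarrow> y \<in> Y \<Longrightarrow> y' \<in> Y \<Longrightarrow>
      \<mu>xy * norm (y - y') \<le> norm (gx x y - gx x y')"
    and gy_lower: "\<And>x x' y. x \<in> X \<Longrightarrow> x' \<in> X \<Longrightarrow> y \<in> Y \<Longrightarrow>
      \<mu>yx * norm (x - x') \<le> norm (gy x y - gy x' y)"
begin

definition Dx :: "'b \<Rightarrow> 'a \<Rightarrow> 'a \<Rightarrow> real" where
  "Dx y = bregman (\<lambda>x. F x y) (\<lambda>x. gx x y)"

definition Dy :: "'a \<Rightarrow> 'b \<Rightarrow> 'b \<Rightarrow> real" where
  "Dy x = bregman (\<lambda>y. - F x y) (\<lambda>y. - gy x y)"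

lemma gx_in: "x \<in> X \<Longrightarrow> y \<in> Y \<Longrightarrow> gx x y \<in> X"
  using smooth_convex_onD(1)[OF convex_x] by blast

lemma gy_in: "x \<in> X \<Longrightarrow> y \<in> Y \<Longrightarrow> gy x y \<in> Y"
  using smooth_convex_onD(1)[OF concave_y] subspace_neg[OF Y, of "- gy x y"] by fastforce

lemma Dx_bounds:
  assumes "y \<in> Y" "a \<in> X" "b \<in> X"
  shows "\<mu>x / 2 * (norm (a - b))\<^sup>2 \<le> Dx y a b" "Dx y a b \<le> Lx / 2 * (norm (a - b))\<^sup>2"
    "(norm (gx a y - gx b y))\<^sup>2 \<le> 2 * Lx * Dx y a b" "0 \<le> Dx y a b"
proof -
  note h = convex_x[OF assms(1)]
  show 1: "\<mu>x / 2 * (norm (a - b))\<^sup>2 \<le> Dx y a b" "Dx y a b \<le> Lx / 2 * (norm (a - b))\<^sup>2"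
    using smooth_convex_onD[OF h assms(2,3)] by (auto simp: Dx_def)
  show "(norm (gx a y - gx b y))\<^sup>2 \<le> 2 * Lx * Dx y a b"
    using grad_diff_sq_le_bregman[OF h X _ _ assms(2,3)] const_bounds by (auto simp: Dx_def)
  show "0 \<le> Dx y a b"
    using const_bounds(1) by (intro order_trans[OF _ 1(1)]) simp
qed

lemma Dy_bounds:
  assumes "x \<in> X" "a \<in> Y" "b \<in> Y"
  shows "\<mu>y / 2 * (norm (a - b))\<^sup>2 \<le> Dy x a b" "Dy x a b \<le> Ly / 2 * (norm (a - b))\<^sup>2"
    "(norm (gy x a - gy x b))\<^sup>2 \<le> 2 * Ly * Dy x a b" "0 \<le> Dy x a b"
proof -
  note h = concave_y[OF assms(1)]
  show 1: "\<mu>y / 2 * (norm (a - b))\<^sup>2 \<le> Dy x a b" "Dy x a b \<le> Ly / 2 * (norm (a - b))\<^sup>2"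
    using smooth_convex_onD[OF h assms(2,3)] by (auto simp: Dy_def)
  show "(norm (gy x a - gy x b))\<^sup>2 \<le> 2 * Ly * Dy x a b"
    using grad_diff_sq_le_bregman[OF h Y _ _ assms(2,3)] const_bounds
    by (auto simp: Dy_def norm_minus_commute)
  show "0 \<le> Dy x a b"
    using const_bounds(3) by (intro order_trans[OF _ 1(1)]) simp
qed

lemma gx_Lipschitz:
  assumes "a \<in> X" "b \<in> X" "y \<in> Y"
  shows "norm (gx a y - gx b y) \<le> Lx * norm (a - b)"
proof (rule power2_le_imp_le)
  have "(norm (gx a y - gx b y))\<^sup>2 \<le> 2 * Lx * (Lx / 2 * (norm (a - b))\<^sup>2)"
    using Dx_bounds(2,3)[OF assms(3,1,2)] const_bounds
    by (meson mult_left_mono order_trans mult_nonneg_nonneg zero_le_numeral)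
  then show "(norm (gx a y - gx b y))\<^sup>2 \<le> (Lx * norm (a - b))\<^sup>2"
    by (simp add: power2_eq_square algebra_simps)
qed (use const_bounds in simp)

lemma gy_Lipschitz:
  assumes "x \<in> X" "a \<in> Y" "b \<in> Y"
  shows "norm (gy x a - gy x b) \<le> Ly * norm (a - b)"
proof (rule power2_le_imp_le)
  have "(norm (gy x a - gy x b))\<^sup>2 \<le> 2 * Ly * (Ly / 2 * (norm (a - b))\<^sup>2)"
    using Dy_bounds(2,3)[OF assms] const_bounds
    by (meson mult_left_mono order_trans mult_nonneg_nonneg zero_le_numeral)
  then show "(norm (gy x a - gy x b))\<^sup>2 \<le> (Ly * norm (a - b))\<^sup>2"
    by (simp add: power2_eq_square algebra_simps)
qed (use const_bounds in simp)

text \<open>This is the monotonicity product of G, written as four non-negative Bregman distances: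
  each of the four values of F at the corners occurs twice, with opposite signs, and
  cancels.\<close>

definition gap :: "'a \<times> 'b \<Rightarrow> 'a \<times> 'b \<Rightarrow> real" where
  "gap z w = Dx (snd z) (fst w) (fst z) + Dx (snd w) (fst z) (fst w)
     + Dy (fst z) (snd w) (snd z) + Dy (fst w) (snd z) (snd w)"

definition G :: "'a \<times> 'b \<Rightarrow> 'a \<times> 'b" where
  "G z = (gx (fst z) (snd z), - gy (fst z) (snd z))"

lemma gap_eq: "gap z w = (G z - G w) \<bullet> (z - w)"
  by (simp add: gap_def G_def Dx_def Dy_def bregman_def inner_prod_def algebra_simps)

lemma gap_nonneg: "z \<in> X \<times> Y \<Longrightarrow> w \<in> X \<times> Y \<Longrightarrow> 0 \<le> gap z w"
  by (auto simp: gap_def intro!: add_nonneg_nonneg Dx_bounds Dy_bounds)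

text \<open>If \<open>\<mu>x > 0\<close>, strong convexity suffices. Otherwise the coupling bounds
  \<open>x - x'\<close> by \<open>gy x y - gy x' y\<close>, which splits at \<open>gy x' y'\<close>:
  the first part is a component of \<open>G z - G w\<close>, the second moves only y and is bounded
  by a Bregman distance through cocoercivity.\<close>

lemma dist_x_le_gap:
  assumes "0 < max \<mu>x \<mu>yx"
  obtains C where "0 \<le> C"
    "\<And>z w. z \<in> X \<times> Y \<Longrightarrow> w \<in> X \<times> Y \<Longrightarrow>
       (norm (fst z - fst w))\<^sup>2 \<le> C * ((norm (G z - G w))\<^sup>2 + gap z w)"
proof (cases "0 < \<mu>x")
  case True
  show ?thesis
  proof (rule that[of "2 / \<mu>x"])
    fix z w assume zw: "z \<in> X \<times> Y" "w \<in> X \<times> Y"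
    have "\<mu>x / 2 * (norm (fst z - fst w))\<^sup>2 \<le> Dx (snd w) (fst z) (fst w)"
      using zw by (intro Dx_bounds) auto
    also have "\<dots> \<le> gap z w"
      unfolding gap_def using zw by (auto intro!: add_nonneg_nonneg Dx_bounds Dy_bounds)
    also have "\<dots> \<le> (norm (G z - G w))\<^sup>2 + gap z w"
      by simp
    finally show "(norm (fst z - fst w))\<^sup>2 \<le> 2 / \<mu>x * ((norm (G z - G w))\<^sup>2 + gap z w)"
      using True by (simp add: field_simps)
  qed (use True in simp)
next
  case False
  then have "0 < \<mu>yx"
    using assms by simp
  show ?thesis
  proof (rule that[of "(2 + 4 * Ly) / \<mu>yx\<^sup>2"])
    fix z w assume zw: "z \<in> X \<times> Y" "w \<in> X \<times> Y"
    obtain x y x' y' where eq: "z = (x, y)" "w = (x', y')"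
      by fastforce
    with zw have in_XY: "x \<in> X" "y \<in> Y" "x' \<in> X" "y' \<in> Y"
      by auto
    have "(\<mu>yx * norm (x - x'))\<^sup>2 \<le> (norm (gy x y - gy x' y))\<^sup>2"
      using gy_lower in_XY const_bounds by (intro power_mono) auto
    also have "gy x y - gy x' y = (gy x y - gy x' y') + (gy x' y' - gy x' y)"
      by simp
    also have "(norm \<dots>)\<^sup>2 \<le> 2 * (norm (gy x y - gy x' y'))\<^sup>2 + 2 * (norm (gy x' y' - gy x' y))\<^sup>2"
      by (rule norm_sum_sq_le2)
    also have "(norm (gy x' y' - gy x' y))\<^sup>2 \<le> 2 * Ly * Dy x' y y'"
      using Dy_bounds(3) in_XY by (metis norm_minus_commute)
    also have "2 * Ly * Dy x' y y' \<le> 2 * Ly * gap z w"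
      using in_XY const_bounds unfolding gap_def eq
      by (intro mult_left_mono) (auto intro!: add_nonneg_nonneg Dx_bounds Dy_bounds)
    also have "(norm (gy x y - gy x' y'))\<^sup>2 \<le> (norm (G z - G w))\<^sup>2"
      using norm_snd_le[of "- (gy x y - gy x' y')" "gx x y - gx x' y'"]
      by (simp add: G_def eq norm_minus_commute)
    finally have "(\<mu>yx * norm (x - x'))\<^sup>2 \<le> 2 * (norm (G z - G w))\<^sup>2 + 4 * Ly * gap z w"
      by simp
    also have "\<dots> \<le> (2 + 4 * Ly) * ((norm (G z - G w))\<^sup>2 + gap z w)"
      using gap_nonneg[OF zw] const_bounds by (simp add: algebra_simps)
    finally show "(norm (fst z - fst w))\<^sup>2
        \<le> (2 + 4 * Ly) / \<mu>yx\<^sup>2 * ((norm (G z - G w))\<^sup>2 + gap z w)"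
      using \<open>0 < \<mu>yx\<close> by (simp add: eq field_simps)
  qed (use const_bounds in simp)
qed

text \<open>The mirror image: the coupling acts through \<open>gx\<close>, and cocoercivity is used
  for the move in x.\<close>

lemma dist_y_le_gap:
  assumes "0 < max \<mu>y \<mu>xy"
  obtains C where "0 \<le> C"
    "\<And>z w. z \<in> X \<times> Y \<Longrightarrow> w \<in> X \<times> Y \<Longrightarrow>
       (norm (snd z - snd w))\<^sup>2 \<le> C * ((norm (G z - G w))\<^sup>2 + gap z w)"
proof (cases "0 < \<mu>y")
  case True
  show ?thesis
  proof (rule that[of "2 / \<mu>y"])
    fix z w assume zw: "z \<in> X \<times> Y" "w \<in> X \<times> Y"
    have "\<mu>y / 2 * (norm (snd z - snd w))\<^sup>2 \<le> Dy (fst w) (snd z) (snd w)"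
      using zw by (intro Dy_bounds) auto
    also have "\<dots> \<le> gap z w"
      unfolding gap_def using zw by (auto intro!: add_nonneg_nonneg Dx_bounds Dy_bounds)
    also have "\<dots> \<le> (norm (G z - G w))\<^sup>2 + gap z w"
      by simp
    finally show "(norm (snd z - snd w))\<^sup>2 \<le> 2 / \<mu>y * ((norm (G z - G w))\<^sup>2 + gap z w)"
      using True by (simp add: field_simps)
  qed (use True in simp)
next
  case False
  then have "0 < \<mu>xy"
    using assms by simp
  show ?thesis
  proof (rule that[of "(2 + 4 * Lx) / \<mu>xy\<^sup>2"])
    fix z w assume zw: "z \<in> X \<times> Y" "w \<in> X \<times> Y"
    obtain x y x' y' where eq: "z = (x, y)" "w = (x', y')"
      by fastforce
    with zw have in_XY: "x \<in> X" "y \<in> Y" "x' \<in> X" "y' \<in> Y"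
      by auto
    have "(\<mu>xy * norm (y - y'))\<^sup>2 \<le> (norm (gx x y - gx x y'))\<^sup>2"
      using gx_lower in_XY const_bounds by (intro power_mono) auto
    also have "gx x y - gx x y' = (gx x y - gx x' y') + (gx x' y' - gx x y')"
      by simp
    also have "(norm \<dots>)\<^sup>2 \<le> 2 * (norm (gx x y - gx x' y'))\<^sup>2 + 2 * (norm (gx x' y' - gx x y'))\<^sup>2"
      by (rule norm_sum_sq_le2)
    also have "(norm (gx x' y' - gx x y'))\<^sup>2 \<le> 2 * Lx * Dx y' x x'"
      using Dx_bounds(3) in_XY by (metis norm_minus_commute)
    also have "2 * Lx * Dx y' x x' \<le> 2 * Lx * gap z w"
      using in_XY const_bounds unfolding gap_def eq
      by (intro mult_left_mono) (auto intro!: add_nonneg_nonneg Dx_bounds Dy_bounds)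
    also have "(norm (gx x y - gx x' y'))\<^sup>2 \<le> (norm (G z - G w))\<^sup>2"
      using norm_fst_le[of "gx x y - gx x' y'" "gy x' y' - gy x y"] by (simp add: G_def eq)
    finally have "(\<mu>xy * norm (y - y'))\<^sup>2 \<le> 2 * (norm (G z - G w))\<^sup>2 + 4 * Lx * gap z w"
      by simp
    also have "\<dots> \<le> (2 + 4 * Lx) * ((norm (G z - G w))\<^sup>2 + gap z w)"
      using gap_nonneg[OF zw] const_bounds by (simp add: algebra_simps)
    finally show "(norm (snd z - snd w))\<^sup>2
        \<le> (2 + 4 * Lx) / \<mu>xy\<^sup>2 * ((norm (G z - G w))\<^sup>2 + gap z w)"
      using \<open>0 < \<mu>xy\<close> by (simp add: eq field_simps)
  qed (use const_bounds in simp)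
qed

text \<open>Since the gap is an inner product, Cauchy-Schwarz bounds it by \<open>g * n\<close>. The
  resulting inequality \<open>n\<^sup>2 \<le> C * g\<^sup>2 + C * g * n\<close> is quadratic in n,
  and half of \<open>n\<^sup>2\<close> absorbs the mixed term.\<close>

lemma G_inverse_Lipschitz:
  assumes "0 < min (max \<mu>x \<mu>yx) (max \<mu>y \<mu>xy)"
  obtains C where "0 \<le> C"
    "\<And>z w. z \<in> X \<times> Y \<Longrightarrow> w \<in> X \<times> Y \<Longrightarrow> norm (z - w) \<le> C * norm (G z - G w)"
proof -
  obtain C1 where C1: "0 \<le> C1" "\<And>z w. z \<in> X \<times> Y \<Longrightarrow> w \<in> X \<times> Y \<Longrightarrow>
       (norm (fst z - fst w))\<^sup>2 \<le> C1 * ((norm (G z - G w))\<^sup>2 + gap z w)"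
    using assms dist_x_le_gap by (metis min_less_iff_conj)
  obtain C2 where C2: "0 \<le> C2" "\<And>z w. z \<in> X \<times> Y \<Longrightarrow> w \<in> X \<times> Y \<Longrightarrow>
       (norm (snd z - snd w))\<^sup>2 \<le> C2 * ((norm (G z - G w))\<^sup>2 + gap z w)"
    using assms dist_y_le_gap by (metis min_less_iff_conj)
  define C where "C = C1 + C2"
  have "0 \<le> C"
    using C1(1) C2(1) by (simp add: C_def)
  show ?thesis
  proof (rule that[of "sqrt (2 * C + C\<^sup>2)"])
    fix z w assume zw: "z \<in> X \<times> Y" "w \<in> X \<times> Y"
    define n g where "n = norm (z - w)" and "g = norm (G z - G w)"
    have "n\<^sup>2 = (norm (fst z - fst w))\<^sup>2 + (norm (snd z - snd w))\<^sup>2"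
      by (simp add: n_def norm_prod_def)
    also have "\<dots> \<le> C * (g\<^sup>2 + gap z w)"
      using C1(2)[OF zw] C2(2)[OF zw] by (simp add: C_def g_def algebra_simps)
    finally have "n\<^sup>2 \<le> C * (g\<^sup>2 + gap z w)" .
    moreover have "C * gap z w \<le> C * (g * n)"
      unfolding gap_eq g_def n_def using \<open>0 \<le> C\<close>
      by (intro mult_left_mono norm_cauchy_schwarz)
    moreover have "2 * ((C * g) * n) \<le> C\<^sup>2 * g\<^sup>2 + n\<^sup>2"
      using sum_squares_bound[of "C * g" n] by (simp add: power_mult_distrib)
    ultimately have "n\<^sup>2 \<le> (2 * C + C\<^sup>2) * g\<^sup>2"
      by (simp add: algebra_simps)
    then have "n \<le> sqrt ((2 * C + C\<^sup>2) * g\<^sup>2)"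
      by (rule real_le_rsqrt)
    then show "norm (z - w) \<le> sqrt (2 * C + C\<^sup>2) * norm (G z - G w)"
      by (simp add: real_sqrt_mult n_def g_def)
  qed (use \<open>0 \<le> C\<close> in simp)
qed

section \<open>Existence and uniqueness of the saddle point\<close>

lemma G_Lipschitz:
  assumes "z \<in> X \<times> Y" "w \<in> X \<times> Y"
  shows "norm (G z - G w) \<le> (Lx + Ly + 2 * Lxy) * norm (z - w)"
proof -
  obtain x y x' y' where eq: "z = (x, y)" "w = (x', y')"
    by fastforce
  with assms have in_XY: "x \<in> X" "y \<in> Y" "x' \<in> X" "y' \<in> Y"
    by auto
  have le: "norm (x - x') \<le> norm (z - w)" "norm (y - y') \<le> norm (z - w)"
    using norm_fst_le[of "x - x'" "y - y'"] norm_snd_le[of "y - y'" "x - x'"] by (simp_all add: eq)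
  have "norm (gx x y - gx x' y') \<le> Lx * norm (z - w) + Lxy * norm (z - w)"
    using norm_triangle_ineq[of "gx x y - gx x' y" "gx x' y - gx x' y'"]
      gx_Lipschitz[of x x' y] gx_upper[of x' y y'] in_XY const_bounds
      mult_left_mono[OF le(1), of Lx] mult_left_mono[OF le(2), of Lxy] by simp
  moreover have "norm (gy x y - gy x' y') \<le> Ly * norm (z - w) + Lxy * norm (z - w)"
    using norm_triangle_ineq[of "gy x y - gy x' y" "gy x' y - gy x' y'"]
      gy_Lipschitz[of x' y y'] gy_upper[of x x' y] in_XY const_bounds
      mult_left_mono[OF le(1), of Lxy] mult_left_mono[OF le(2), of Ly] by simp
  moreover have "norm (G z - G w) \<le> norm (gx x y - gx x' y') + norm (gy x y - gy x' y')"
    using norm_Pair_le[of "gx x y - gx x' y'" "gy x' y' - gy x y"]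
    by (simp add: G_def eq norm_minus_commute)
  ultimately show ?thesis
    by (simp add: algebra_simps)
qed

lemma solution_exists:
  assumes "0 < min (max \<mu>x \<mu>yx) (max \<mu>y \<mu>xy)" "complete X" "complete Y"
  shows "\<exists>x\<in>X. \<exists>y\<in>Y. gx x y = 0 \<and> gy x y = 0"
proof -
  obtain C where C: "0 \<le> C"
    "\<And>z w. z \<in> X \<times> Y \<Longrightarrow> w \<in> X \<times> Y \<Longrightarrow> norm (z - w) \<le> C * norm (G z - G w)"
    using G_inverse_Lipschitz[OF assms(1)] by blast
  have "\<exists>z\<in>X \<times> Y. G z = 0"
  proof (rule monotone_zero_exists[OF _ _ _ G_Lipschitz _ C(2)])
    show "subspace (X \<times> Y)" "complete (X \<times> Y)"
      using X Y assms(2,3) by (auto intro: subspace_Times complete_Times)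
    show "G z \<in> X \<times> Y" if "z \<in> X \<times> Y" for z
      using that Y by (auto simp: G_def intro!: gx_in subspace_neg gy_in)
    show "0 \<le> (G z - G w) \<bullet> (z - w)" if "z \<in> X \<times> Y" "w \<in> X \<times> Y" for z w
      using gap_nonneg[OF that] by (simp add: gap_eq)
  qed (use C(1) const_bounds in simp_all)
  then show ?thesis
    by (auto simp: G_def zero_prod_def)
qed

lemma solution_unique:
  assumes "0 < min (max \<mu>x \<mu>yx) (max \<mu>y \<mu>xy)"
    and "x \<in> X" "y \<in> Y" "gx x y = 0" "gy x y = 0"
    and "x' \<in> X" "y' \<in> Y" "gx x' y' = 0" "gy x' y' = 0"
  shows "x = x' \<and> y = y'"
proof -
  obtain C where C: "0 \<le> C"
    "\<And>z w. z \<in> X \<times> Y \<Longrightarrow> w \<in> X \<times> Y \<Longrightarrow> norm (z - w) \<le> C * norm (G z - G w)"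
    using G_inverse_Lipschitz[OF assms(1)] by blast
  have "norm ((x, y) - (x', y')) \<le> C * norm (G (x, y) - G (x', y'))"
    using assms by (intro C) auto
  also have "G (x, y) - G (x', y') = 0"
    using assms by (simp add: G_def zero_prod_def)
  finally show ?thesis
    by (simp add: zero_prod_def)
qed

end


section \<open>Decay of the energy\<close>

lemma norm_sq_three_point:
  "(norm (a - c))\<^sup>2 = (norm (b - c))\<^sup>2 - (norm (a - b))\<^sup>2 + 2 * ((a - b) \<bullet> (a - c))"
  for a b c :: "'a::real_inner"
  using norm_diff_scaleR_sq[of "a - c" 1 "a - b"] by simp

context smooth_saddle
begin

text \<open>Here e is the latest gradient difference used for extrapolation and d the latest step in
  y. The inner product carries the coupling error over to the next step, where the extrapolation
  cancels it up to a term in \<open>x' - x\<close>; the last summand pays for that term.\<close>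

definition energy ::
    "real \<Rightarrow> real \<Rightarrow> real \<Rightarrow> 'a \<Rightarrow> 'b \<Rightarrow> 'a \<Rightarrow> 'b \<Rightarrow> 'a \<Rightarrow> 'b \<Rightarrow> real" where
  "energy p q \<rho> xs ys e d x y =
     (1 + \<rho>) * ((norm (x - xs))\<^sup>2 / p) + (1 + \<rho>) * ((norm (y - ys))\<^sup>2 / q)
     - 2 * (e \<bullet> (x - xs)) + 1 / 4 * ((norm d)\<^sup>2 / q)"

text \<open>This is how the condition on \<open>p * q * Lxy\<^sup>2\<close> enters the energy
  estimates.\<close>

lemma extrapolation_le:
  assumes "0 < p" "0 < q" "p * q * Lxy\<^sup>2 \<le> 1 / 64"
    and "x \<in> X" "y \<in> Y" "y' \<in> Y"
  shows "p * (norm (gx x y - gx x y'))\<^sup>2 \<le> 1 / 64 * ((norm (y - y'))\<^sup>2 / q)"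
proof -
  have "q * (p * (norm (gx x y - gx x y'))\<^sup>2) \<le> q * (p * (Lxy * norm (y - y'))\<^sup>2)"
    using gx_upper assms by (intro mult_left_mono power_mono) auto
  also have "\<dots> = (p * q * Lxy\<^sup>2) * (norm (y - y'))\<^sup>2"
    by (simp add: power_mult_distrib)
  also have "\<dots> \<le> 1 / 64 * (norm (y - y'))\<^sup>2"
    using assms(3) by (rule mult_right_mono) simp
  finally show ?thesis
    using \<open>0 < q\<close> by (simp add: field_simps)
qed

text \<open>The inner product has no sign. Young's inequality with weight 2p charges it to half of
  the x distance and to 1/32 of the last step in y, so the energy still controls both
  distances.\<close>

lemma energy_lower_bound:
  assumes "0 < p" "0 < q" "0 \<le> \<rho>" "p * q * Lxy\<^sup>2 \<le> 1 / 64"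
    and "x \<in> X" "y \<in> Y" "ym \<in> Y" "xm \<in> X"
  shows "1 / 2 * ((norm (x - xs))\<^sup>2 / p) + (norm (y - ys))\<^sup>2 / q
    \<le> energy p q \<rho> xs ys (gx xm y - gx xm ym) (y - ym) x y"
proof -
  define e where "e = gx xm y - gx xm ym"
  have "2 * \<bar>e \<bullet> (x - xs)\<bar> \<le> 2 * p * (norm e)\<^sup>2 + (norm (x - xs))\<^sup>2 / (2 * p)"
    using assms(1) by (intro two_inner_le) simp
  moreover have "p * (norm e)\<^sup>2 \<le> 1 / 64 * ((norm (y - ym))\<^sup>2 / q)"
    unfolding e_def using assms by (intro extrapolation_le)
  moreover have "0 \<le> \<rho> * ((norm (x - xs))\<^sup>2 / p)" "0 \<le> \<rho> * ((norm (y - ys))\<^sup>2 / q)"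
    "0 \<le> (norm (y - ym))\<^sup>2 / q"
    using assms by simp_all
  moreover have "(norm (x - xs))\<^sup>2 / (2 * p) = 1 / 2 * ((norm (x - xs))\<^sup>2 / p)"
    by simp
  ultimately show ?thesis
    unfolding energy_def e_def[symmetric] distrib_right by linarith
qed

text \<open>The three-point identities of both updates are added. The four Bregman distances and the
  squared steps \<open>U / p\<close>, \<open>V / q\<close> that they release pay for the smoothness
  errors, for the extrapolation error and for the surplus \<rho> in the weights of the new
  energy.\<close>

lemma energy_step:
  assumes pq: "0 < p" "0 < q" "p * Lx \<le> 1 / 8" "q * Ly \<le> 1 / 8" "p * q * Lxy\<^sup>2 \<le> 1 / 64"
    and \<rho>: "0 < \<rho>" "\<rho> \<le> 1" "\<rho> \<le> max (p * \<mu>x) (p * q * \<mu>yx\<^sup>2 / 8)"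
      "\<rho> \<le> max (q * \<mu>y) (p * q * \<mu>xy\<^sup>2 / 8)"
    and sol: "xs \<in> X" "ys \<in> Y" "gx xs ys = 0" "gy xs ys = 0"
    and in_XY: "x \<in> X" "y \<in> Y" "xm \<in> X" "ym \<in> Y"
    and e: "e = gx xm y - gx xm ym"
    and \<theta>: "\<theta> = 1 / (1 + \<rho>)"
    and x': "x' = x - p *\<^sub>R gx x y - (p * \<theta>) *\<^sub>R e"
    and y': "y' = y + q *\<^sub>R gy x' y"
    and e': "e' = gx x y' - gx x y"
  shows "energy p q \<rho> xs ys e' (y' - y) x' y' \<le> \<theta> * energy p q \<rho> xs ys e (y - ym) x y"
proof -
  have x'_in: "x' \<in> X"
    unfolding x' e using in_XY X by (intro subspace_diff subspace_scale gx_in) auto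
  have y'_in: "y' \<in> Y"
    unfolding y' using in_XY Y x'_in by (intro subspace_add subspace_scale gy_in) auto
  have \<theta>_bounds: "1 / 2 \<le> \<theta>" "\<theta> \<le> 1" "\<theta> * (1 + \<rho>) = 1"
    using \<rho>(1,2) by (auto simp: \<theta> field_simps)
  define v where "v = gx x y + \<theta> *\<^sub>R e"
  have step_x: "x' - x = - (p *\<^sub>R v)"
    by (simp add: x' v_def algebra_simps)
  have step_y: "y' - y = q *\<^sub>R gy x' y"
    by (simp add: y')
  \<comment> \<open>Seen from the new \<open>y'\<close>, the direction v is the gradient there up to
    two corrections: \<open>e'\<close> cancels against the new energy, and
    \<open>\<theta> *\<^sub>R e\<close> reproduces \<theta> times the inner product in the old
    one.\<close>
  have v_eq: "v = gx x y' - e' + \<theta> *\<^sub>R e"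
    by (simp add: v_def e')
  define U V W where "U = (norm (x' - x))\<^sup>2" and "V = (norm (y' - y))\<^sup>2" and "W = (norm (y - ym))\<^sup>2"
  define A A' B B' where "A = (norm (x - xs))\<^sup>2" and "A' = (norm (x' - xs))\<^sup>2"
    and "B = (norm (y - ys))\<^sup>2" and "B' = (norm (y' - ys))\<^sup>2"
  define D1 D2 D3 D4 where "D1 = Dx y' xs x" and "D2 = Dy x' ys y"
    and "D3 = Dx ys x' xs" and "D4 = Dy xs y' ys"
  have D_nonneg: "0 \<le> D1" "0 \<le> D2" "0 \<le> D3" "0 \<le> D4"
    unfolding D1_def D2_def D3_def D4_def using in_XY sol x'_in y'_in
    by (auto intro: Dx_bounds Dy_bounds)
  have nonneg: "0 \<le> U / p" "0 \<le> V / q" "0 \<le> W / q"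
    using pq by (auto simp: U_def V_def W_def)

  have "A' = A - U + 2 * ((x' - x) \<bullet> (x' - xs))"
    unfolding A_def A'_def U_def by (rule norm_sq_three_point)
  then have x_identity: "A' / p = A / p - U / p - 2 * (v \<bullet> (x' - xs))"
    using pq(1) unfolding step_x by (simp add: diff_divide_distrib)
  have "B' = B - V + 2 * ((y' - y) \<bullet> (y' - ys))"
    unfolding B_def B'_def V_def by (rule norm_sq_three_point)
  then have y_identity: "B' / q = B / q - V / q + 2 * (gy x' y \<bullet> (y' - ys))"
    using pq(2) unfolding step_y by (simp add: diff_divide_distrib add_divide_distrib)
  have v_inner: "v \<bullet> (x' - xs) = gx x y' \<bullet> (x' - xs) - e' \<bullet> (x' - xs)
      + \<theta> * (e \<bullet> (x - xs)) + \<theta> * (e \<bullet> (x' - x))"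
    unfolding v_eq by (simp add: algebra_simps)
  \<comment> \<open>In the sum of both identities \<open>F x' y'\<close> cancels. What is left of F
    is -2 (D3 + D4), because the gradients vanish at the solution.\<close>
  have gap_x: "gx x y' \<bullet> (x' - xs) = D1 - Dx y' x' x + F x' y' - F xs y'"
    by (simp add: D1_def Dx_def bregman_def algebra_simps)
  have gap_y: "gy x' y \<bullet> (y' - ys) = F x' y' - F x' ys - D2 + Dy x' y' y"
    by (simp add: D2_def Dy_def bregman_def algebra_simps)
  have gap_sol: "D3 = F x' ys - F xs ys" "D4 = F xs ys - F xs y'"
    using sol by (simp_all add: D3_def D4_def Dx_def Dy_def bregman_def)

  have smooth_x: "Dx y' x' x \<le> 1 / 16 * (U / p)"
  proof -
    have "Dx y' x' x \<le> Lx / 2 * U"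
      unfolding U_def using in_XY x'_in y'_in by (intro Dx_bounds)
    also have "\<dots> \<le> (1 / (16 * p)) * U"
      using pq by (intro mult_right_mono) (auto simp: U_def field_simps)
    finally show ?thesis by simp
  qed
  have smooth_y: "Dy x' y' y \<le> 1 / 16 * (V / q)"
  proof -
    have "Dy x' y' y \<le> Ly / 2 * V"
      unfolding V_def using in_XY x'_in y'_in by (intro Dy_bounds)
    also have "\<dots> \<le> (1 / (16 * q)) * V"
      using pq by (intro mult_right_mono) (auto simp: V_def field_simps)
    finally show ?thesis by simp
  qed
  have e_le: "p * (norm e)\<^sup>2 \<le> 1 / 64 * (W / q)"
    unfolding e W_def using pq in_XY by (intro extrapolation_le)
  have e'_le: "p * (norm e')\<^sup>2 \<le> 1 / 64 * (V / q)"
    unfolding e' V_def using pq in_XY y'_in by (intro extrapolation_le)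
  \<comment> \<open>Young's inequality with weight 4p, followed by \<open>e_le\<close>.\<close>
  have cross: "- 2 * (\<theta> * (e \<bullet> (x' - x))) \<le> 1 / 4 * (U / p) + 1 / 16 * (W / q)"
  proof -
    have "- 2 * (\<theta> * (e \<bullet> (x' - x))) = \<theta> * (- 2 * (e \<bullet> (x' - x)))"
      by simp
    also have "\<dots> \<le> \<theta> * (2 * \<bar>e \<bullet> (x' - x)\<bar>)"
      using \<theta>_bounds by (intro mult_left_mono) auto
    also have "\<dots> \<le> 2 * \<bar>e \<bullet> (x' - x)\<bar>"
      using \<theta>_bounds by (intro mult_left_le_one_le) auto
    also have "\<dots> \<le> 4 * p * (norm e)\<^sup>2 + U / (4 * p)"
      unfolding U_def using pq(1) by (intro two_inner_le) simp
    finally show ?thesis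
      using e_le by simp
  qed

  \<comment> \<open>This and \<open>strong_y\<close> bound the surplus of the new energy by
    quantities that are available with a larger negative coefficient, except that 2 D3 and 2 D4 are
    spent in full.\<close>
  have strong_x: "\<rho> * (A' / p) \<le> 2 * D3 + 1 / 2 * D2 + 1 / 4 * (V / q)"
  proof (cases "\<rho> \<le> p * \<mu>x")
    case True
    then have "\<rho> * (A' / p) \<le> (p * \<mu>x) * (A' / p)"
      using pq(1) by (intro mult_right_mono) (auto simp: A'_def)
    also have "\<dots> = 2 * (\<mu>x / 2 * A')"
      using pq(1) by simp
    also have "\<dots> \<le> 2 * D3"
      unfolding D3_def A'_def using sol x'_in by (intro mult_left_mono Dx_bounds) auto
    finally show ?thesis
      using D_nonneg nonneg by linarith
  next
    case False
    then have "\<rho> * (A' / p) \<le> (p * q * \<mu>yx\<^sup>2 / 8) * (A' / p)"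
      using pq(1) \<rho>(3) by (intro mult_right_mono) (auto simp: A'_def)
    also have "\<dots> = q / 8 * (\<mu>yx * norm (x' - xs))\<^sup>2"
      using pq(1) by (simp add: A'_def power_mult_distrib)
    also have "\<dots> \<le> q / 8 * (norm (gy x' ys - gy xs ys))\<^sup>2"
      using pq(2) sol x'_in const_bounds by (intro mult_left_mono power_mono gy_lower) auto
    \<comment> \<open>The first summand is controlled by D2 through cocoercivity; the second is the
      step in y divided by q.\<close>
    also have "gy x' ys - gy xs ys = (gy x' ys - gy x' y) + gy x' y"
      using sol by simp
    also have "q / 8 * (norm \<dots>)\<^sup>2
        \<le> q / 8 * (2 * (norm (gy x' ys - gy x' y))\<^sup>2 + 2 * (norm (gy x' y))\<^sup>2)"
      using pq(2) by (intro mult_left_mono norm_sum_sq_le2) auto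
    also have "\<dots> \<le> q / 8 * (2 * (2 * Ly * D2) + 2 * (norm (gy x' y))\<^sup>2)"
      unfolding D2_def using pq(2) in_XY sol x'_in
      by (intro mult_left_mono add_right_mono Dy_bounds) auto
    also have "\<dots> = 1 / 2 * ((q * Ly) * D2) + 1 / 4 * (V / q)"
      using pq(2) unfolding V_def step_y by (simp add: field_simps power2_eq_square)
    also have "(q * Ly) * D2 \<le> 1 / 8 * D2"
      using pq(4) D_nonneg(2) by (rule mult_right_mono)
    finally show ?thesis
      using D_nonneg by linarith
  qed

  have strong_y: "\<rho> * (B' / q) \<le> 2 * D4 + 1 / 2 * D1 + 1 / 2 * (U / p)
      + 1 / 64 * (V / q) + 1 / 64 * (W / q)"
  proof (cases "\<rho> \<le> q * \<mu>y")
    case True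
    then have "\<rho> * (B' / q) \<le> (q * \<mu>y) * (B' / q)"
      using pq(2) by (intro mult_right_mono) (auto simp: B'_def)
    also have "\<dots> = 2 * (\<mu>y / 2 * B')"
      using pq(2) by simp
    also have "\<dots> \<le> 2 * D4"
      unfolding D4_def B'_def using sol y'_in by (intro mult_left_mono Dy_bounds) auto
    finally show ?thesis
      using D_nonneg nonneg by linarith
  next
    case False
    \<comment> \<open>As \<open>gx xs ys = 0\<close> and \<open>b = gx x y'\<close>, the sum a + b
      is the gradient difference at xs. Cocoercivity bounds a by D1, while v is the step in x
      divided by -p.\<close>
    define a b where "a = gx xs y' - gx x y'" and "b = v + (e' - \<theta> *\<^sub>R e)"
    have "\<rho> * (B' / q) \<le> (p * q * \<mu>xy\<^sup>2 / 8) * (B' / q)"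
      using False pq(2) \<rho>(4) by (intro mult_right_mono) (auto simp: B'_def)
    also have "\<dots> = p / 8 * (\<mu>xy * norm (y' - ys))\<^sup>2"
      using pq(2) by (simp add: B'_def power_mult_distrib)
    also have "\<dots> \<le> p / 8 * (norm (gx xs y' - gx xs ys))\<^sup>2"
      using pq(1) sol y'_in const_bounds by (intro mult_left_mono power_mono gx_lower) auto
    also have "gx xs y' - gx xs ys = a + b"
      using sol by (simp add: v_eq a_def b_def)
    finally have "\<rho> * (B' / q) \<le> p / 8 * (norm (a + b))\<^sup>2" .
    moreover have "(norm (a + b))\<^sup>2 \<le> 2 * (norm a)\<^sup>2 + 2 * (norm b)\<^sup>2"
      by (rule norm_sum_sq_le2)
    moreover have "(norm b)\<^sup>2 \<le> 2 * (norm v)\<^sup>2 + 2 * (norm (e' - \<theta> *\<^sub>R e))\<^sup>2"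
      unfolding b_def by (rule norm_sum_sq_le2)
    moreover have "(norm (e' - \<theta> *\<^sub>R e))\<^sup>2 \<le> 2 * (norm e')\<^sup>2 + 2 * (norm e)\<^sup>2"
    proof -
      have "(norm (e' - \<theta> *\<^sub>R e))\<^sup>2 \<le> 2 * (norm e')\<^sup>2 + 2 * (\<theta> * norm e)\<^sup>2"
        using norm_sum_sq_le2[of e' "- (\<theta> *\<^sub>R e)"] by (simp add: power_mult_distrib)
      also have "(\<theta> * norm e)\<^sup>2 \<le> (norm e)\<^sup>2"
        using \<theta>_bounds by (intro power_mono mult_left_le_one_le) auto
      finally show ?thesis by simp
    qed
    ultimately have "\<rho> * (B' / q) \<le> p / 8 * (2 * (norm a)\<^sup>2
        + 2 * (2 * (norm v)\<^sup>2 + 2 * (2 * (norm e')\<^sup>2 + 2 * (norm e)\<^sup>2)))"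
      using pq(1) by (smt (verit) mult_left_mono divide_nonneg_nonneg)
    also have "\<dots> = 1 / 4 * (p * (norm a)\<^sup>2) + 1 / 2 * (p * (norm v)\<^sup>2)
        + (p * (norm e')\<^sup>2) + (p * (norm e)\<^sup>2)"
      by (simp add: algebra_simps)
    also have "p * (norm v)\<^sup>2 = U / p"
      using pq(1) unfolding U_def step_x by (simp add: power_mult_distrib power2_eq_square)
    finally have "\<rho> * (B' / q) \<le> 1 / 4 * (p * (norm a)\<^sup>2) + 1 / 2 * (U / p)
        + (p * (norm e')\<^sup>2) + (p * (norm e)\<^sup>2)" .
    moreover have "p * (norm a)\<^sup>2 \<le> 1 / 4 * D1"
    proof -
      have "p * (norm a)\<^sup>2 \<le> p * (2 * Lx * D1)"
        unfolding a_def D1_def using pq(1) in_XY sol y'_in by (intro mult_left_mono Dx_bounds) auto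
      also have "\<dots> = 2 * ((p * Lx) * D1)"
        by simp
      also have "(p * Lx) * D1 \<le> 1 / 8 * D1"
        using pq(3) D_nonneg(1) by (rule mult_right_mono)
      finally show ?thesis by simp
    qed
    ultimately show ?thesis
      using e_le e'_le D_nonneg by linarith
  qed

  have "energy p q \<rho> xs ys e' (y' - y) x' y'
      = A' / p + \<rho> * (A' / p) + B' / q + \<rho> * (B' / q) - 2 * (e' \<bullet> (x' - xs)) + 1 / 4 * (V / q)"
    by (simp add: energy_def A'_def B'_def V_def add_divide_distrib algebra_simps)
  \<comment> \<open>The budget: \<open>U / p\<close> is charged 1/8 + 1/4 + 1/2 against 1,
    \<open>V / q\<close> is charged 1/8 + 1/4 + 1/64 + 1/4 against 1, D1 and D2 are charged 1/2
    against 2, and \<open>W / q\<close> collects 1/16 + 1/64.\<close>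
  also have "\<dots> \<le> A / p + B / q - 2 * (\<theta> * (e \<bullet> (x - xs))) + 1 / 8 * (W / q)"
    using x_identity y_identity v_inner gap_x gap_y gap_sol smooth_x smooth_y cross
      strong_x strong_y D_nonneg nonneg by linarith
  \<comment> \<open>Here \<open>\<rho> \<le> 1\<close> enters, in the form
    \<open>\<theta> \<ge> 1 / 2\<close>.\<close>
  also have "1 / 8 * (W / q) \<le> \<theta> * (1 / 4 * (W / q))"
  proof -
    have "1 / 2 * (1 / 4 * (W / q)) \<le> \<theta> * (1 / 4 * (W / q))"
      using \<theta>_bounds(1) nonneg(3) by (intro mult_right_mono) auto
    then show ?thesis by simp
  qed
  also have "A / p + B / q - 2 * (\<theta> * (e \<bullet> (x - xs))) + \<theta> * (1 / 4 * (W / q))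
      = (\<theta> * (1 + \<rho>)) * (A / p) + (\<theta> * (1 + \<rho>)) * (B / q)
        - 2 * (\<theta> * (e \<bullet> (x - xs))) + \<theta> * (1 / 4 * (W / q))"
    by (simp only: \<theta>_bounds(3) mult_1)
  also have "\<dots> = \<theta> * energy p q \<rho> xs ys e (y - ym) x y"
    by (simp add: energy_def A_def B_def W_def add_divide_distrib algebra_simps)
  finally show ?thesis
    by simp
qed

lemma linear_convergence:
  fixes x :: "nat \<Rightarrow> 'a" and y :: "nat \<Rightarrow> 'b"
  assumes pq: "0 < p" "0 < q" "p * Lx \<le> 1 / 8" "q * Ly \<le> 1 / 8" "p * q * Lxy\<^sup>2 \<le> 1 / 64"
    and \<rho>: "0 < \<rho>" "\<rho> \<le> 1" "\<rho> \<le> max (p * \<mu>x) (p * q * \<mu>yx\<^sup>2 / 8)"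
      "\<rho> \<le> max (q * \<mu>y) (p * q * \<mu>xy\<^sup>2 / 8)"
    and sol: "xs \<in> X" "ys \<in> Y" "gx xs ys = 0" "gy xs ys = 0"
    and start: "x 0 \<in> X" "y 0 \<in> Y"
    and x_Suc: "\<And>k. x (Suc k) = x k - p *\<^sub>R gx (x k) (y k)
      - (p * (1 / (1 + \<rho>))) *\<^sub>R (gx (x (k - 1)) (y k) - gx (x (k - 1)) (y (k - 1)))"
    and y_Suc: "\<And>k. y (Suc k) = y k + q *\<^sub>R gy (x (Suc k)) (y k)"
  shows "\<exists>C>0. \<forall>k. max ((norm (x k - xs))\<^sup>2) ((norm (y k - ys))\<^sup>2) \<le> C * (1 / (1 + \<rho>)) ^ k"
proof -
  have in_XY: "x k \<in> X \<and> y k \<in> Y" for k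
  \<comment> \<open>Strong induction, since an iterate depends on the two before it.\<close>
  proof (induction k rule: less_induct)
    case (less k)
    show ?case
    proof (cases k)
      case (Suc j)
      then have j: "x j \<in> X" "y j \<in> Y" "x (j - 1) \<in> X" "y (j - 1) \<in> Y"
        using less by auto
      then have "x k \<in> X"
        unfolding Suc x_Suc using X by (intro subspace_diff subspace_scale gx_in) auto
      moreover from this j have "y k \<in> Y"
        unfolding Suc y_Suc using Y by (intro subspace_add subspace_scale gy_in) auto
      ultimately show ?thesis by simp
    qed (use start in simp)
  qed
  \<comment> \<open>For k = 0 truncated subtraction makes both the extrapolation difference and the
    last step in y vanish, in agreement with the start of the algorithm.\<close>
  define E where "E k = energy p q \<rho> xs ys
    (gx (x (k - 1)) (y k) - gx (x (k - 1)) (y (k - 1))) (y k - y (k - 1)) (x k) (y k)" for k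
  have E_lower: "1 / 2 * ((norm (x k - xs))\<^sup>2 / p) + (norm (y k - ys))\<^sup>2 / q \<le> E k" for k
    unfolding E_def using in_XY pq \<rho>(1) by (intro energy_lower_bound) auto
  have E_Suc: "E (Suc k) \<le> 1 / (1 + \<rho>) * E k" for k
    unfolding E_def diff_Suc_1
    by (rule energy_step[OF pq \<rho> sol _ _ _ _ refl refl x_Suc y_Suc refl]) (use in_XY in auto)
  have E_le: "E k \<le> E 0 * (1 / (1 + \<rho>)) ^ k" for k
  proof (induction k)
    case (Suc k)
    have "E (Suc k) \<le> 1 / (1 + \<rho>) * (E 0 * (1 / (1 + \<rho>)) ^ k)"
      using \<rho>(1) Suc by (intro order_trans[OF E_Suc] mult_left_mono) auto
    then show ?case by (simp add: algebra_simps)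
  qed simp
  have E_nonneg: "0 \<le> E k" for k
    using pq by (intro order_trans[OF _ E_lower]) simp
  show ?thesis
  \<comment> \<open>The factors 2p and q come from \<open>E_lower\<close>; adding 1 keeps the
    constant positive when the start is already the solution.\<close>
  proof (intro exI[of _ "(2 * p + q) * E 0 + 1"] conjI allI)
    fix k
    have x_le: "(norm (x k - xs))\<^sup>2 \<le> 2 * p * E k" and y_le: "(norm (y k - ys))\<^sup>2 \<le> q * E k"
    proof -
      have "0 \<le> (norm (x k - xs))\<^sup>2 / p" "0 \<le> (norm (y k - ys))\<^sup>2 / q"
        using pq by simp_all
      then have "1 / 2 * ((norm (x k - xs))\<^sup>2 / p) \<le> E k" "(norm (y k - ys))\<^sup>2 / q \<le> E k"
        using E_lower[of k] by linarith+
      then show "(norm (x k - xs))\<^sup>2 \<le> 2 * p * E k" "(norm (y k - ys))\<^sup>2 \<le> q * E k"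
        using pq by (simp_all add: field_simps)
    qed
    have "max ((norm (x k - xs))\<^sup>2) ((norm (y k - ys))\<^sup>2) \<le> (2 * p + q) * E k"
      using x_le y_le mult_nonneg_nonneg[OF _ E_nonneg[of k], of p]
        mult_nonneg_nonneg[OF _ E_nonneg[of k], of q] pq(1,2) by (simp add: algebra_simps)
    also have "\<dots> \<le> (2 * p + q) * (E 0 * (1 / (1 + \<rho>)) ^ k)"
      using pq(1,2) E_le by (intro mult_left_mono) auto
    also have "\<dots> \<le> ((2 * p + q) * E 0 + 1) * (1 / (1 + \<rho>)) ^ k"
      using \<rho>(1) by (simp add: algebra_simps)
    finally show "max ((norm (x k - xs))\<^sup>2) ((norm (y k - ys))\<^sup>2)
        \<le> ((2 * p + q) * E 0 + 1) * (1 / (1 + \<rho>)) ^ k" .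
  qed (use E_nonneg[of 0] pq(1,2) in \<open>simp add: add_nonneg_pos\<close>)
qed

end


section \<open>Step sizes and iteration count\<close>

lemma ratio_le_ereal_iff: "ratio a b \<le> ereal t \<longleftrightarrow> b \<noteq> 0 \<and> a / b \<le> t"
  by (simp add: ratio_def)

lemma T_min_le_ereal_iff:
  "T_min Lx Ly Lxy \<mu>x \<mu>y \<mu>xy \<mu>yx \<le> ereal t \<longleftrightarrow>
     T_a Lx Ly Lxy \<mu>x \<mu>y \<le> ereal t \<or> T_b Lx Ly Lxy \<mu>x \<mu>xy \<le> ereal t \<or>
     T_c Lx Ly Lxy \<mu>y \<mu>yx \<le> ereal t \<or> T_d Lx Ly Lxy \<mu>xy \<mu>yx \<le> ereal t"
  unfolding T_min_def by (subst Min_le_iff) auto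

lemma
  shows T_a_le_ereal_iff: "T_a Lx Ly Lxy \<mu>x \<mu>y \<le> ereal t \<longleftrightarrow>
      \<mu>x \<noteq> 0 \<and> Lx / \<mu>x \<le> t \<and> \<mu>y \<noteq> 0 \<and> Ly / \<mu>y \<le> t \<and> Lxy / sqrt (\<mu>x * \<mu>y) \<le> t"
    and T_b_le_ereal_iff: "T_b Lx Ly Lxy \<mu>x \<mu>xy \<le> ereal t \<longleftrightarrow>
      \<mu>x \<noteq> 0 \<and> Lx / \<mu>x \<le> t \<and> \<mu>xy \<noteq> 0 \<and> Lx * Ly / \<mu>xy\<^sup>2 \<le> t \<and> Lxy\<^sup>2 / \<mu>xy\<^sup>2 \<le> t"
    and T_c_le_ereal_iff: "T_c Lx Ly Lxy \<mu>y \<mu>yx \<le> ereal t \<longleftrightarrow>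
      \<mu>y \<noteq> 0 \<and> Ly / \<mu>y \<le> t \<and> \<mu>yx \<noteq> 0 \<and> Lx * Ly / \<mu>yx\<^sup>2 \<le> t \<and> Lxy\<^sup>2 / \<mu>yx\<^sup>2 \<le> t"
    and T_d_le_ereal_iff: "T_d Lx Ly Lxy \<mu>xy \<mu>yx \<le> ereal t \<longleftrightarrow>
      \<mu>xy \<noteq> 0 \<and> \<mu>yx \<noteq> 0 \<and> Lx * Ly / \<mu>xy\<^sup>2 \<le> t \<and> Lx * Ly / \<mu>yx\<^sup>2 \<le> t \<and>
      Lxy\<^sup>2 / \<mu>xy\<^sup>2 \<le> t \<and> Lxy\<^sup>2 / \<mu>yx\<^sup>2 \<le> t"
  unfolding T_a_def T_b_def T_c_def T_d_def by (auto simp: ratio_le_ereal_iff)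

text \<open>Each of \<open>T_a\<close>, \<open>T_b\<close>, \<open>T_c\<close> contains a condition
  number L / \<mu>, which is at least 1, so only \<open>T_d\<close> can be below 1. The conclusion
  contradicts the two-sided bounds on the coupling unless both spaces are trivial.\<close>

lemma coupling_less_if_T_min_less_1:
  assumes T: "T_min Lx Ly Lxy \<mu>x \<mu>y \<mu>xy \<mu>yx \<le> ereal t" "t < 1"
    and "0 \<le> \<mu>x" "\<mu>x \<le> Lx" "0 \<le> \<mu>y" "\<mu>y \<le> Ly" "0 < Lxy" "0 \<le> \<mu>xy" "0 \<le> \<mu>yx"
  shows "0 \<le> t" "Lxy < \<mu>xy" "Lxy < \<mu>yx"
proof -
  have not_x: "\<not> (\<mu>x \<noteq> 0 \<and> Lx / \<mu>x \<le> t)" and not_y: "\<not> (\<mu>y \<noteq> 0 \<and> Ly / \<mu>y \<le> t)"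
    using assms by (auto simp: not_le intro: less_le_trans[OF \<open>t < 1\<close>])
  have less: "0 \<le> t \<and> Lxy < \<mu>" if "\<mu> \<noteq> 0" "0 \<le> \<mu>" "Lxy\<^sup>2 / \<mu>\<^sup>2 \<le> t" for \<mu>
  proof -
    have "Lxy\<^sup>2 / \<mu>\<^sup>2 < 1"
      by (rule le_less_trans[OF that(3) \<open>t < 1\<close>])
    moreover have "0 < \<mu>\<^sup>2"
      using that by simp
    ultimately have "Lxy\<^sup>2 < \<mu>\<^sup>2"
      by (simp only: divide_less_eq_1_pos)
    then have "Lxy < \<mu>"
      using that(2) by (rule power2_less_imp_less)
    moreover have "0 \<le> t"
      by (rule order_trans[OF _ that(3)]) simp
    ultimately show ?thesis
      by simp
  qed
  have "T_d Lx Ly Lxy \<mu>xy \<mu>yx \<le> ereal t"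
    using T(1) not_x not_y
    unfolding T_min_le_ereal_iff T_a_le_ereal_iff T_b_le_ereal_iff T_c_le_ereal_iff by metis
  then show "0 \<le> t" "Lxy < \<mu>xy" "Lxy < \<mu>yx"
    using less[of \<mu>xy] less[of \<mu>yx] assms(8,9) by (simp_all add: T_d_le_ereal_iff)
qed

text \<open>In the cases that use a lower coupling bound, only the product of the step sizes matters
  for the coupling. Its value balances both demands: \<open>p * q * Lxy\<^sup>2\<close> is
  \<open>Lxy\<^sup>2 / m / t\<close> divided by 64, and \<open>p * q * m / 8\<close> is exactly the
  desired rate.\<close>

lemma step_size_products:
  fixes p q t m Lxy :: real
  assumes "0 < t" "0 < m" "Lxy\<^sup>2 / m \<le> t" and pq: "p * q = 1 / (64 * t * m)"
  shows "p * q * Lxy\<^sup>2 \<le> 1 / 64" "m \<le> \<mu>\<^sup>2 \<Longrightarrow> 1 / (512 * t) \<le> p * q * \<mu>\<^sup>2 / 8"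
proof -
  have "Lxy\<^sup>2 / m / t \<le> 1"
    using assms(1,3) by (simp only: divide_le_eq_1_pos)
  moreover have "p * q * Lxy\<^sup>2 = 1 / 64 * (Lxy\<^sup>2 / m / t)"
    by (simp add: pq)
  ultimately show "p * q * Lxy\<^sup>2 \<le> 1 / 64"
    by simp
  assume "m \<le> \<mu>\<^sup>2"
  have "1 / (512 * t) = p * q * m / 8"
    using assms by (simp add: field_simps)
  also have "\<dots> \<le> p * q * \<mu>\<^sup>2 / 8"
    using \<open>m \<le> \<mu>\<^sup>2\<close> assms by (intro divide_right_mono mult_left_mono) (auto simp: pq)
  finally show "1 / (512 * t) \<le> p * q * \<mu>\<^sup>2 / 8" .
qed

lemma step_sizes_exist:
  assumes T: "T_min Lx Ly Lxy \<mu>x \<mu>y \<mu>xy \<mu>yx \<le> ereal t" "1 \<le> t"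
    and bounds: "0 \<le> \<mu>x" "\<mu>x \<le> Lx" "0 \<le> \<mu>y" "\<mu>y \<le> Ly" "0 < Lxy"
  obtains p q where "0 < p" "0 < q" "p * Lx \<le> 1 / 8" "q * Ly \<le> 1 / 8" "p * q * Lxy\<^sup>2 \<le> 1 / 64"
    "1 / (512 * t) \<le> max (p * \<mu>x) (p * q * \<mu>yx\<^sup>2 / 8)"
    "1 / (512 * t) \<le> max (q * \<mu>y) (p * q * \<mu>xy\<^sup>2 / 8)"
proof -
  have "0 < t"
    using T(2) by simp
  have less: "1 / (512 * t) \<le> 1 / (8 * t)"
    using \<open>0 < t\<close> by (simp add: field_simps)
  have strong: "1 / (512 * t) \<le> 1 / (8 * L) * \<mu>" if "L / \<mu> \<le> t" "0 < \<mu>" "\<mu> \<le> L" for L \<mu> :: real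
  proof -
    have "1 / (8 * t) \<le> 1 / (8 * L) * \<mu>"
      using that \<open>0 < t\<close> by (simp add: field_simps)
    with less show ?thesis by linarith
  qed
  from T(1) consider
      (a) "T_a Lx Ly Lxy \<mu>x \<mu>y \<le> ereal t" | (b) "T_b Lx Ly Lxy \<mu>x \<mu>xy \<le> ereal t"
    | (c) "T_c Lx Ly Lxy \<mu>y \<mu>yx \<le> ereal t" | (d) "T_d Lx Ly Lxy \<mu>xy \<mu>yx \<le> ereal t"
    unfolding T_min_le_ereal_iff by blast
  then show ?thesis
  proof cases
    case a
    then have *: "0 < \<mu>x" "0 < \<mu>y" "Lx / \<mu>x \<le> t" "Ly / \<mu>y \<le> t" "Lxy / sqrt (\<mu>x * \<mu>y) \<le> t"
      using bounds by (auto simp: T_a_le_ereal_iff)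
    have "(Lxy / sqrt (\<mu>x * \<mu>y))\<^sup>2 \<le> t\<^sup>2"
      using * bounds by (intro power_mono) auto
    then have Lxy: "Lxy\<^sup>2 / (\<mu>x * \<mu>y) \<le> t\<^sup>2"
      using * by (simp add: power_divide)
    \<comment> \<open>With these step sizes both \<open>p * \<mu>x\<close> and
      \<open>q * \<mu>y\<close> equal \<open>1 / (8 * t)\<close>, and the conditions on
      \<open>p * Lx\<close> and \<open>q * Ly\<close> become the bounds on the condition
      numbers.\<close>
    show ?thesis
    proof (rule that[of "1 / (8 * t * \<mu>x)" "1 / (8 * t * \<mu>y)"])
      show "1 / (8 * t * \<mu>x) * (1 / (8 * t * \<mu>y)) * Lxy\<^sup>2 \<le> 1 / 64"
        using * Lxy \<open>0 < t\<close> by (simp add: field_simps power2_eq_square)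
    qed (use * \<open>0 < t\<close> less in \<open>auto simp: field_simps le_max_iff_disj\<close>)
  next
    case b
    then have *: "0 < \<mu>x" "0 < Lx" "Lx / \<mu>x \<le> t" "0 < \<mu>xy\<^sup>2" "Lx * Ly / \<mu>xy\<^sup>2 \<le> t" "Lxy\<^sup>2 / \<mu>xy\<^sup>2 \<le> t"
      using bounds by (auto simp: T_b_le_ereal_iff)
    \<comment> \<open>p is the largest step that smoothness in x allows, and the prescribed product
      then determines q. The condition on \<open>q * Ly\<close> becomes
      \<open>Lx * Ly / \<mu>xy\<^sup>2 \<le> t\<close>. Case c exchanges the roles.\<close>
    define p q where "p = 1 / (8 * Lx)" and "q = Lx / (8 * t * \<mu>xy\<^sup>2)"
    have pq: "p * q = 1 / (64 * t * \<mu>xy\<^sup>2)"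
      using * by (simp add: p_def q_def)
    show ?thesis
    proof (rule that[of p q])
      show "q * Ly \<le> 1 / 8"
        using * \<open>0 < t\<close> by (simp add: q_def field_simps)
      show "1 / (512 * t) \<le> max (p * \<mu>x) (p * q * \<mu>yx\<^sup>2 / 8)"
        using strong[OF *(3,1)] bounds by (simp add: p_def le_max_iff_disj)
      show "1 / (512 * t) \<le> max (q * \<mu>y) (p * q * \<mu>xy\<^sup>2 / 8)"
        using step_size_products(2)[OF \<open>0 < t\<close> *(4,6) pq order_refl] by simp
      show "p * q * Lxy\<^sup>2 \<le> 1 / 64"
        by (rule step_size_products(1)[OF \<open>0 < t\<close> *(4,6) pq])
    qed (use * \<open>0 < t\<close> in \<open>simp_all add: p_def q_def\<close>)
  next
    case c
    then have *: "0 < \<mu>y" "0 < Ly" "Ly / \<mu>y \<le> t" "0 < \<mu>yx\<^sup>2" "Lx * Ly / \<mu>yx\<^sup>2 \<le> t" "Lxy\<^sup>2 / \<mu>yx\<^sup>2 \<le> t"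
      using bounds by (auto simp: T_c_le_ereal_iff)
    define p q where "p = Ly / (8 * t * \<mu>yx\<^sup>2)" and "q = 1 / (8 * Ly)"
    have pq: "p * q = 1 / (64 * t * \<mu>yx\<^sup>2)"
      using * by (simp add: p_def q_def)
    show ?thesis
    proof (rule that[of p q])
      show "p * Lx \<le> 1 / 8"
        using * \<open>0 < t\<close> by (simp add: p_def field_simps)
      show "1 / (512 * t) \<le> max (p * \<mu>x) (p * q * \<mu>yx\<^sup>2 / 8)"
        using step_size_products(2)[OF \<open>0 < t\<close> *(4,6) pq order_refl] by simp
      show "1 / (512 * t) \<le> max (q * \<mu>y) (p * q * \<mu>xy\<^sup>2 / 8)"
        using strong[OF *(3,1)] bounds by (simp add: q_def le_max_iff_disj)
      show "p * q * Lxy\<^sup>2 \<le> 1 / 64"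
        by (rule step_size_products(1)[OF \<open>0 < t\<close> *(4,6) pq])
    qed (use * \<open>0 < t\<close> in \<open>simp_all add: p_def q_def\<close>)
  next
    case d
    \<comment> \<open>The smaller coupling fixes the product, so that both effective moduli reach
      the rate.\<close>
    define m where "m = min (\<mu>xy\<^sup>2) (\<mu>yx\<^sup>2)"
    have *: "0 < m" "Lx * Ly / m \<le> t" "Lxy\<^sup>2 / m \<le> t"
      using d by (auto simp: T_d_le_ereal_iff m_def min_def)
    have ex: "\<exists>p>0. \<exists>q>0. p * Lx \<le> 1 / 8 \<and> q * Ly \<le> 1 / 8 \<and> p * q = 1 / (64 * t * m)"
    proof (cases "Lx = 0")
      case True
      \<comment> \<open>For Lx = 0 there is no upper limit on p; it is taken large enough that the q
        given by the product satisfies \<open>q * Ly \<le> 1 / 8\<close>. The summand 1 covers Ly =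
        0.\<close>
      define p where "p = Ly / (8 * t * m) + 1"
      have "0 < p"
        using * \<open>0 < t\<close> bounds by (simp add: p_def add_nonneg_pos)
      moreover have "Ly \<le> p * (8 * t * m)"
        using * \<open>0 < t\<close> by (simp add: p_def distrib_right)
      ultimately show ?thesis
        using * \<open>0 < t\<close> True
        by (intro exI[of _ p] exI[of _ "1 / (64 * t * m) / p"] conjI) (simp_all add: field_simps)
    next
      case False
      then have "0 < Lx"
        using bounds by simp
      then show ?thesis
        using * \<open>0 < t\<close>
        by (intro exI[of _ "1 / (8 * Lx)"] exI[of _ "Lx / (8 * t * m)"] conjI)
          (simp_all add: field_simps)
    qed
    then obtain p q where pq: "0 < p" "0 < q" "p * Lx \<le> 1 / 8" "q * Ly \<le> 1 / 8"
      "p * q = 1 / (64 * t * m)"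
      by blast
    note products = step_size_products[OF \<open>0 < t\<close> *(1,3) pq(5)]
    show ?thesis
      using products(2)[of \<mu>xy] products(2)[of \<mu>yx]
      by (intro that[OF pq(1-4) products(1)]) (auto simp: m_def)
  qed
qed

text \<open>For \<open>0 < \<rho> \<le> 1\<close> the rate \<open>1 / (1 + \<rho>)\<close> is at
  most \<open>1 - \<rho> / 2\<close>, hence at most \<open>exp (- (\<rho> / 2))\<close>. With
  \<open>\<rho> = 1 / (512 * t)\<close> this halving is the source of the constant 1024.\<close>

lemma iterations_suffice:
  assumes "1 \<le> t" "0 < C" "0 < \<epsilon>" and k: "1024 * t * max 0 (ln (C / \<epsilon>)) \<le> real k"
  shows "C * (1 / (1 + 1 / (512 * t))) ^ k \<le> \<epsilon>"
proof -
  define \<rho> where "\<rho> = 1 / (512 * t)"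
  have \<rho>: "0 < \<rho>" "\<rho> \<le> 1"
    using assms(1) by (auto simp: \<rho>_def)
  have "1 / (1 + \<rho>) \<le> 1 + - (\<rho> / 2)"
    using \<rho> by (simp add: field_simps power2_eq_square mult_left_le)
  also have "\<dots> \<le> exp (- (\<rho> / 2))"
    by (rule exp_ge_add_one_self)
  finally have "(1 / (1 + \<rho>)) ^ k \<le> exp (- (\<rho> / 2)) ^ k"
    using \<rho> by (intro power_mono) auto
  also have "\<dots> = exp (- (real k * (\<rho> / 2)))"
    by (simp add: exp_of_nat_mult[symmetric])
  also have "\<dots> \<le> exp (- ln (C / \<epsilon>))"
  proof -
    have "ln (C / \<epsilon>) \<le> max 0 (ln (C / \<epsilon>))"
      by simp
    also have "\<dots> = 1024 * t * max 0 (ln (C / \<epsilon>)) * (\<rho> / 2)"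
      using assms(1) by (simp add: \<rho>_def)
    also have "\<dots> \<le> real k * (\<rho> / 2)"
      using \<rho> by (intro mult_right_mono[OF k]) simp
    finally show ?thesis by simp
  qed
  also have "\<dots> = \<epsilon> / C"
    using assms(2,3) by (simp add: exp_minus)
  finally show ?thesis
    using assms(2) by (simp add: \<rho>_def field_simps)
qed

section \<open>From gradients on \<open>Rn d\<close> to the abstract saddle setting\<close>

lemma smooth_convex_on_grad:
  assumes "smooth_strongly_convex d L \<mu> h"
  shows "smooth_convex_on (Rn d) L \<mu> h (grad d h)"
  using assms by (auto simp: smooth_strongly_convex_def smooth_convex_on_def bregman_def grad_in_Rn)

text \<open>Differentiability is given for \<open>- h\<close>, so \<open>grad_minus\<close> is
  applied to that function and the double negation yields the gradient of h.\<close>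

lemma smooth_convex_on_minus_grad:
  assumes "smooth_strongly_convex d L \<mu> (\<lambda>v. - h v)"
  shows "smooth_convex_on (Rn d) L \<mu> (\<lambda>v. - h v) (\<lambda>v. - grad d h v)"
proof -
  have "- grad d h v = grad d (\<lambda>v. - h v) v" if "v \<in> Rn d" for v
    using grad_minus[of "\<lambda>v. - h v" d v] assms that by (simp add: smooth_strongly_convex_def)
  then show ?thesis
    using smooth_convex_on_grad[OF assms] by (simp add: smooth_convex_on_def bregman_def)
qed

theorem theorem6p4:
  shows "\<exists>K>0. \<forall>(dx::nat) (dy::nat) (F :: fsvec \<Rightarrow> fsvec \<Rightarrow> real)
      (Lx::real) (Ly::real) (Lxy::real) (\<mu>x::real) (\<mu>y::real) (\<mu>xy::real) (\<mu>yx::real).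
    (\<lambda>(x, y). F x y) differentiable_on (Rn dx \<times> Rn dy) \<longrightarrow>
    Lx \<ge> \<mu>x \<longrightarrow> \<mu>x \<ge> 0 \<longrightarrow> Ly \<ge> \<mu>y \<longrightarrow> \<mu>y \<ge> 0 \<longrightarrow> Lxy > 0 \<longrightarrow> \<mu>xy \<ge> 0 \<longrightarrow> \<mu>yx \<ge> 0 \<longrightarrow>
    (\<forall>y\<in>Rn dy. smooth_strongly_convex dx Lx \<mu>x (\<lambda>x. F x y)) \<longrightarrow>
    (\<forall>x\<in>Rn dx. smooth_strongly_convex dy Ly \<mu>y (\<lambda>y. - F x y)) \<longrightarrow>
    (\<forall>x\<in>Rn dx. \<forall>y1\<in>Rn dy. \<forall>y2\<in>Rn dy.
       norm (grad_x dx F x y1 - grad_x dx F x y2) \<le> Lxy * norm (y1 - y2)) \<longrightarrow>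
    (\<forall>y\<in>Rn dy. \<forall>x1\<in>Rn dx. \<forall>x2\<in>Rn dx.
       norm (grad_y dy F x1 y - grad_y dy F x2 y) \<le> Lxy * norm (x1 - x2)) \<longrightarrow>
    (\<forall>x\<in>Rn dx. \<forall>y1\<in>Rn dy. \<forall>y2\<in>Rn dy.
       norm (grad_x dx F x y1 - grad_x dx F x y2) \<ge> \<mu>xy * norm (y1 - y2)) \<longrightarrow>
    (\<forall>y\<in>Rn dy. \<forall>x1\<in>Rn dx. \<forall>x2\<in>Rn dx.
       norm (grad_y dy F x1 y - grad_y dy F x2 y) \<ge> \<mu>yx * norm (x1 - x2)) \<longrightarrow>
    min (max \<mu>x \<mu>yx) (max \<mu>y \<mu>xy) > 0 \<longrightarrow>
    (\<exists>\<eta>x>0. \<exists>\<eta>y>0. \<exists>\<theta>. 0 < \<theta> \<and> \<theta> < 1 \<and>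
      (\<forall>x0\<in>Rn dx. \<forall>y0\<in>Rn dy. \<exists>C>0. \<forall>\<epsilon>>0. \<exists>k::nat.
         int k \<le> \<lceil>K * real_of_ereal (T_min Lx Ly Lxy \<mu>x \<mu>y \<mu>xy \<mu>yx) * max 0 (ln (C / \<epsilon>))\<rceil> \<and>
         accurate_solution dx dy F \<epsilon> (gdae dx dy F \<eta>x \<eta>y \<theta> x0 y0 k)))"
proof (rule exI[of _ 1024], intro conjI allI impI)
  fix dx dy :: nat and F :: "fsvec \<Rightarrow> fsvec \<Rightarrow> real" and Lx Ly Lxy \<mu>x \<mu>y \<mu>xy \<mu>yx :: real
  assume bounds: "\<mu>x \<le> Lx" "0 \<le> \<mu>x" "\<mu>y \<le> Ly" "0 \<le> \<mu>y" "0 < Lxy" "0 \<le> \<mu>xy" "0 \<le> \<mu>yx"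
    and convex: "\<forall>y\<in>Rn dy. smooth_strongly_convex dx Lx \<mu>x (\<lambda>x. F x y)"
    and concave: "\<forall>x\<in>Rn dx. smooth_strongly_convex dy Ly \<mu>y (\<lambda>y. - F x y)"
    and upper: "\<forall>x\<in>Rn dx. \<forall>y1\<in>Rn dy. \<forall>y2\<in>Rn dy.
       norm (grad_x dx F x y1 - grad_x dx F x y2) \<le> Lxy * norm (y1 - y2)"
      "\<forall>y\<in>Rn dy. \<forall>x1\<in>Rn dx. \<forall>x2\<in>Rn dx.
       norm (grad_y dy F x1 y - grad_y dy F x2 y) \<le> Lxy * norm (x1 - x2)"
    and lower: "\<forall>x\<in>Rn dx. \<forall>y1\<in>Rn dy. \<forall>y2\<in>Rn dy.
       norm (grad_x dx F x y1 - grad_x dx F x y2) \<ge> \<mu>xy * norm (y1 - y2)"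
      "\<forall>y\<in>Rn dy. \<forall>x1\<in>Rn dx. \<forall>x2\<in>Rn dx.
       norm (grad_y dy F x1 y - grad_y dy F x2 y) \<ge> \<mu>yx * norm (x1 - x2)"
    and pos: "min (max \<mu>x \<mu>yx) (max \<mu>y \<mu>xy) > 0"
  interpret smooth_saddle "Rn dx" "Rn dy" F "grad_x dx F" "grad_y dy F" Lx Ly Lxy \<mu>x \<mu>y \<mu>xy \<mu>yx
    using bounds convex concave upper lower smooth_convex_on_grad smooth_convex_on_minus_grad
    by unfold_locales (auto simp: subspace_Rn grad_x_def[abs_def] grad_y_def[abs_def])
  obtain xs ys where sol: "xs \<in> Rn dx" "ys \<in> Rn dy" "grad_x dx F xs ys = 0" "grad_y dy F xs ys = 0"
    using solution_exists[OF pos complete_Rn complete_Rn] by blast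
  then have solutions: "solutions dx dy F = {(xs, ys)}"
    using solution_unique[OF pos] by (auto simp: solutions_def)
  \<comment> \<open>The solution set is a singleton, so its element is trivially the nearest
    solution.\<close>
  have accurate: "accurate_solution dx dy F \<epsilon> (x, y)"
    if "max ((norm (x - xs))\<^sup>2) ((norm (y - ys))\<^sup>2) \<le> \<epsilon>" for \<epsilon> x y
    using that by (auto simp: accurate_solution_def solutions is_arg_min_def sq_dist_def)
  define t where "t = real_of_ereal (T_min Lx Ly Lxy \<mu>x \<mu>y \<mu>xy \<mu>yx)"
  have T: "T_min Lx Ly Lxy \<mu>x \<mu>y \<mu>xy \<mu>yx \<le> ereal t"
    using T_min_finite[of Lxy Lx Ly \<mu>x \<mu>y \<mu>xy \<mu>yx] bounds pos by (simp add: t_def ereal_real)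
  show "\<exists>\<eta>x>0. \<exists>\<eta>y>0. \<exists>\<theta>. 0 < \<theta> \<and> \<theta> < 1 \<and>
      (\<forall>x0\<in>Rn dx. \<forall>y0\<in>Rn dy. \<exists>C>0. \<forall>\<epsilon>>0. \<exists>k::nat.
         int k \<le> \<lceil>1024 * real_of_ereal (T_min Lx Ly Lxy \<mu>x \<mu>y \<mu>xy \<mu>yx) * max 0 (ln (C / \<epsilon>))\<rceil> \<and>
         accurate_solution dx dy F \<epsilon> (gdae dx dy F \<eta>x \<eta>y \<theta> x0 y0 k))"
    unfolding t_def[symmetric]
  \<comment> \<open>For small t the value \<open>1 / (512 * t)\<close> could exceed 1, so the energy
    argument is used for \<open>t \<ge> 1\<close>.\<close>
  proof (cases "t < 1")
    case True
    \<comment> \<open>Then \<open>Rn dx\<close> and \<open>Rn dy\<close> are both trivial, and no iteration is needed.\<close>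
    note less = coupling_less_if_T_min_less_1[OF T True bounds(2,1,4,3,5-7)]
    have x_0: "x = 0" if "x \<in> Rn dx" for x
    proof (rule ccontr)
      assume "x \<noteq> 0"
      then have "Lxy * norm (x - 0) < \<mu>yx * norm (x - 0)"
        using less(2,3) by simp
      with gy_upper[of x 0 0] gy_lower[of x 0 0] show False
        using that subspace_0[OF subspace_Rn] by (metis leD order_trans)
    qed
    have y_0: "y = 0" if "y \<in> Rn dy" for y
    proof (rule ccontr)
      assume "y \<noteq> 0"
      then have "Lxy * norm (y - 0) < \<mu>xy * norm (y - 0)"
        using less(2,3) by simp
      with gx_upper[of 0 y 0] gx_lower[of 0 y 0] show False
        using that subspace_0[OF subspace_Rn] by (metis leD order_trans)
    qed
    have "int 0 \<le> \<lceil>1024 * t * max 0 (ln (1 / \<epsilon>))\<rceil>" for \<epsilon>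
      using less(1) ceiling_mono[of 0 "1024 * t * max 0 (ln (1 / \<epsilon>))"] by simp
    moreover have "accurate_solution dx dy F \<epsilon> (gdae dx dy F 1 1 (1 / 2) x0 y0 0)"
      if "x0 \<in> Rn dx" "y0 \<in> Rn dy" "0 < \<epsilon>" for x0 y0 \<epsilon>
      using accurate[of x0 y0 \<epsilon>] x_0[OF that(1)] y_0[OF that(2)] x_0[OF sol(1)] y_0[OF sol(2)] that(3)
      by simp
    moreover have "0 < (1::real)" "0 < (1 / 2 :: real)" "(1 / 2 :: real) < 1"
      by simp_all
    ultimately show "\<exists>\<eta>x>0. \<exists>\<eta>y>0. \<exists>\<theta>. 0 < \<theta> \<and> \<theta> < 1 \<and>
        (\<forall>x0\<in>Rn dx. \<forall>y0\<in>Rn dy. \<exists>C>0. \<forall>\<epsilon>>0. \<exists>k::nat.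
          int k \<le> \<lceil>1024 * t * max 0 (ln (C / \<epsilon>))\<rceil> \<and>
          accurate_solution dx dy F \<epsilon> (gdae dx dy F \<eta>x \<eta>y \<theta> x0 y0 k))"
      by meson
  next
    case False
    then have "1 \<le> t"
      by simp
    define \<rho> where "\<rho> = 1 / (512 * t)"
    have \<rho>: "0 < \<rho>" "\<rho> \<le> 1"
      using \<open>1 \<le> t\<close> by (auto simp: \<rho>_def)
    obtain p q where pq: "0 < p" "0 < q" "p * Lx \<le> 1 / 8" "q * Ly \<le> 1 / 8" "p * q * Lxy\<^sup>2 \<le> 1 / 64"
      and rate: "\<rho> \<le> max (p * \<mu>x) (p * q * \<mu>yx\<^sup>2 / 8)" "\<rho> \<le> max (q * \<mu>y) (p * q * \<mu>xy\<^sup>2 / 8)"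
      using step_sizes_exist[OF T \<open>1 \<le> t\<close> bounds(2,1,4,3,5)] unfolding \<rho>_def by blast
    have reached: "\<exists>C>0. \<forall>\<epsilon>>0. \<exists>k::nat. int k \<le> \<lceil>1024 * t * max 0 (ln (C / \<epsilon>))\<rceil> \<and>
        accurate_solution dx dy F \<epsilon> (gdae dx dy F p q (1 / (1 + \<rho>)) x0 y0 k)"
      if start: "x0 \<in> Rn dx" "y0 \<in> Rn dy" for x0 y0
    proof -
      define z where "z = gdae dx dy F p q (1 / (1 + \<rho>)) x0 y0"
      have "\<exists>C>0. \<forall>k. max ((norm (fst (z k) - xs))\<^sup>2) ((norm (snd (z k) - ys))\<^sup>2)
          \<le> C * (1 / (1 + \<rho>)) ^ k"
      proof (rule linear_convergence[OF pq \<rho> rate sol,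
            where x = "\<lambda>k. fst (z k)" and y = "\<lambda>k. snd (z k)"])
        show "fst (z 0) \<in> Rn dx" "snd (z 0) \<in> Rn dy"
          using start by (simp_all add: z_def)
        show "fst (z (Suc k)) = fst (z k) - p *\<^sub>R grad_x dx F (fst (z k)) (snd (z k))
            - (p * (1 / (1 + \<rho>))) *\<^sub>R (grad_x dx F (fst (z (k - 1))) (snd (z k))
              - grad_x dx F (fst (z (k - 1))) (snd (z (k - 1))))"
          "snd (z (Suc k)) = snd (z k) + q *\<^sub>R grad_y dy F (fst (z (Suc k))) (snd (z k))" for k
          by (simp_all add: z_def Let_def case_prod_unfold)
      qed
      then obtain C where C: "0 < C" "\<And>k. max ((norm (fst (z k) - xs))\<^sup>2) ((norm (snd (z k) - ys))\<^sup>2)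
          \<le> C * (1 / (1 + \<rho>)) ^ k"
        by blast
      have "\<exists>k. int k \<le> \<lceil>1024 * t * max 0 (ln (C / \<epsilon>))\<rceil> \<and> accurate_solution dx dy F \<epsilon> (z k)"
        if "0 < \<epsilon>" for \<epsilon>
      proof -
        define N where "N = 1024 * t * max 0 (ln (C / \<epsilon>))"
        have "0 \<le> N"
          using \<open>1 \<le> t\<close> by (simp add: N_def)
        have "N \<le> real (nat \<lceil>N\<rceil>)"
          by (rule real_nat_ceiling_ge)
        then have "C * (1 / (1 + \<rho>)) ^ nat \<lceil>N\<rceil> \<le> \<epsilon>"
          unfolding \<rho>_def N_def using \<open>1 \<le> t\<close> C(1) \<open>0 < \<epsilon>\<close> by (intro iterations_suffice)
        then have "accurate_solution dx dy F \<epsilon> (z (nat \<lceil>N\<rceil>))"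
          using accurate[OF order_trans[OF C(2)], of "nat \<lceil>N\<rceil>"] by simp
        moreover have "int (nat \<lceil>N\<rceil>) \<le> \<lceil>N\<rceil>"
          using \<open>0 \<le> N\<close> by simp
        ultimately show ?thesis
          unfolding N_def[symmetric] by (intro exI[of _ "nat \<lceil>N\<rceil>"] conjI)
      qed
      with C(1) show ?thesis
        unfolding z_def[symmetric] by (intro exI[of _ C] conjI allI impI)
    qed
    have \<theta>: "0 < 1 / (1 + \<rho>)" "1 / (1 + \<rho>) < 1"
      using \<rho> by simp_all
    show "\<exists>\<eta>x>0. \<exists>\<eta>y>0. \<exists>\<theta>. 0 < \<theta> \<and> \<theta> < 1 \<and>
        (\<forall>x0\<in>Rn dx. \<forall>y0\<in>Rn dy. \<exists>C>0. \<forall>\<epsilon>>0. \<exists>k::nat.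
          int k \<le> \<lceil>1024 * t * max 0 (ln (C / \<epsilon>))\<rceil> \<and>
          accurate_solution dx dy F \<epsilon> (gdae dx dy F \<eta>x \<eta>y \<theta> x0 y0 k))"
      by (intro exI[of _ p] exI[of _ q] exI[of _ "1 / (1 + \<rho>)"] conjI ballI pq(1,2) \<theta> reached)
  qed
qed simp

end
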